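(* Let $\alpha$ be a composition and $n$ a positive integer. Then in $\mathbf{NSym}$, $$\mathbf{s}_\alpha\cdot\mathbf{s}_{(n)}=\sum \mathbf{s}_{u_{i_n}\cdots u_{i_1}(\alpha)},$$ where the sum ranges over all sequences of positive integers $i_1<i_2<\cdots<i_n$ such that $u_{i_n}\cdots u_{i_1}(\alpha)$ is a composition (necessarily of $|\alpha|+n$), and $$\mathbf{s}_\alpha\cdot\mathbf{s}_{(1^n)}=\sum \mathbf{s}_{u_{i_n}\cdots u_{i_1}(\alpha)},$$ where the sum ranges over all sequences of positive integers $i_1\geq i_2\geq\cdots\geq i_n$ such that $u_{i_n}\cdots u_{i_1}(\alpha)$ is a composition. Here $(1^n)$ is the composition with $n$ parts equal to $1$.
   Context: Compositions have positive parts; $l(\alpha)$ is the number of parts and $|\alpha|$ the sum. For compositions $\alpha,\beta$, write $\alpha\succcurlyeq\beta$ if the parts of $\alpha$ are obtained by adding together adjacent parts of $\beta$ in order. $\mathbf{NSym}=\mathbb{Q}\langle\mathbf{h}_1,\mathbf{h}_2,\ldots\rangle$ is the free associative algebra, with $\mathbf{h}_\alpha=\mathbf{h}_{\alpha_1}\cdots\mathbf{h}_{\alpha_k}$, and the ribbon functions are $\mathbf{r}_\beta=\sum_{\alpha\succcurlyeq\beta}(-1)^{l(\beta)-l(\alpha)}\mathbf{h}_\alpha$. Reverse composition diagram: row $r$ (from the top) of $\alpha$ has $\alpha_r$ left-justified boxes; $(r,c)$ is row $r$, column $c$. A standard reverse composition tableau (SRCT) of shape $\alpha\vDash m$ is a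 bijective filling $\tau$ of the diagram by $\{1,\ldots,m\}$ such that rows decrease from left to right, the first column increases from top to bottom, and for rows $r<s$ and column $c$ with $(s,c+1)$ a box: if $\tau(r,c)>\tau(s,c+1)$ then $(r,c+1)$ is a box and $\tau(r,c+1)>\tau(s,c+1)$. Its descent set is the set of $j\in[m-1]$ such that $j+1$ lies in a column weakly to the right of the column of $j$; if the descent set is $\{j_1<\cdots<j_t\}$, the descent composition is $(j_1,j_2-j_1,\ldots,m-j_t)$. The noncommutative Schur functions $\mathbf{s}_\alpha$ are the unique elements of $\mathbf{NSym}$ with $\mathbf{r}_\beta=\sum_{\alpha\vDash|\beta|}d_{\alpha\beta}\mathbf{s}_\alpha$ for all $\beta$, where $d_{\alpha\beta}$ is the number of SRCTs of shape $\alpha$ with descent composition $\beta$. Operators on compositions: for $i\geq1$, $\mathfrak{d}_i(\alpha)$ is obtained by subtracting $1$ from the rightmost part of $\alpha$ equal to $i$ (deleting a resulting $0$), and $\mathfrak{d}_i(\alpha)=0$ if $\alpha$ has no part equal to $i$; all operators send $0$ to $0$. $\mathfrak{v}_{[i-1]}=\mathfrak{d}_1\mathfrak{d}_2\cdots\mathfrak{d}_{i-1}$ (apply $\mathfrak{d}_{i-1}$ first, then $\mathfrak{d}_{i-2}$, ..., then $\mathfrak{d}_1$; $\mathfrak{v}_{[0]}$ is the identity), $a_i$ appends a part $i$ at the end, and $u_i=a_i\mathfrak{v}_{[i-1]}$. *)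

theory Defs
  imports Complex_Main
begin

definition composition :: "nat list \<Rightarrow> bool" where
  "composition \<alpha> \<longleftrightarrow> (\<forall>x\<in>set \<alpha>. 0 < x)"

definition comps :: "nat \<Rightarrow> nat list set" where
  "comps m = {\<alpha>. composition \<alpha> \<and> sum_list \<alpha> = m}"

definition coarsens :: "nat list \<Rightarrow> nat list \<Rightarrow> bool" where
  "coarsens \<alpha> \<beta> \<longleftrightarrow> (\<exists>L. (\<forall>l\<in>set L. l \<noteq> []) \<and> concat L = \<beta> \<and> map sum_list L = \<alpha>)"

section \<open>NSym: free associative algebra over Q in h_1, h_2, ...\<close>

text \<open>An element of NSym is represented by its coefficient function in the basis
  h_alpha (alpha a composition); only finitely many coefficients are nonzero for the
  elements we use, and the product is concatenation-convolution.\<close>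

type_synonym nsym = "nat list \<Rightarrow> rat"

definition nsym_mult :: "nsym \<Rightarrow> nsym \<Rightarrow> nsym" where
  "nsym_mult f g = (\<lambda>\<gamma>. \<Sum>k\<in>{0..length \<gamma>}. f (take k \<gamma>) * g (drop k \<gamma>))"

definition hbasis :: "nat list \<Rightarrow> nsym" where
  "hbasis \<alpha> = (\<lambda>\<gamma>. if \<gamma> = \<alpha> then 1 else 0)"

definition ribbon :: "nat list \<Rightarrow> nsym" where
  "ribbon \<beta> = (\<lambda>\<gamma>. if coarsens \<gamma> \<beta>
      then (-1) ^ (length \<beta> - length \<gamma>) else 0)"

definition diagram :: "nat list \<Rightarrow> (nat \<times> nat) set" where
  "diagram \<alpha> = {(r, c). 1 \<le> r \<and> r \<le> length \<alpha> \<and> 1 \<le> c \<and> c \<le> \<alpha> ! (r - 1)}"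

definition SRCT :: "nat list \<Rightarrow> (nat \<times> nat \<Rightarrow> nat) \<Rightarrow> bool" where
  "SRCT \<alpha> \<tau> \<longleftrightarrow>
     bij_betw \<tau> (diagram \<alpha>) {1..sum_list \<alpha>} \<and>
     (\<forall>x. x \<notin> diagram \<alpha> \<longrightarrow> \<tau> x = 0) \<and>
     (\<forall>r c. (r, c) \<in> diagram \<alpha> \<longrightarrow> (r, c + 1) \<in> diagram \<alpha> \<longrightarrow> \<tau> (r, c) > \<tau> (r, c + 1)) \<and>
     (\<forall>r s. r < s \<longrightarrow> (r, 1) \<in> diagram \<alpha> \<longrightarrow> (s, 1) \<in> diagram \<alpha> \<longrightarrow> \<tau> (r, 1) < \<tau> (s, 1)) \<and>
     (\<forall>r s c. r < s \<longrightarrow> (r, c) \<in> diagram \<alpha> \<longrightarrow> (s, c + 1) \<in> diagram \<alpha> \<longrightarrow>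
        \<tau> (r, c) > \<tau> (s, c + 1) \<longrightarrow>
        ((r, c + 1) \<in> diagram \<alpha> \<and> \<tau> (r, c + 1) > \<tau> (s, c + 1)))"

definition entry_col :: "nat list \<Rightarrow> (nat \<times> nat \<Rightarrow> nat) \<Rightarrow> nat \<Rightarrow> nat" where
  "entry_col \<alpha> \<tau> j = snd (inv_into (diagram \<alpha>) \<tau> j)"

definition descent_set :: "nat list \<Rightarrow> (nat \<times> nat \<Rightarrow> nat) \<Rightarrow> nat set" where
  "descent_set \<alpha> \<tau> = {j. 1 \<le> j \<and> j < sum_list \<alpha> \<and> entry_col \<alpha> \<tau> j \<le> entry_col \<alpha> \<tau> (j + 1)}"

definition set_to_comp :: "nat \<Rightarrow> nat set \<Rightarrow> nat list" where
  "set_to_comp m S = (if m = 0 then [] else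
     (let ps = 0 # sorted_list_of_set S @ [m]
      in map (\<lambda>k. ps ! (k + 1) - ps ! k) [0..<length ps - 1]))"

definition descent_comp :: "nat list \<Rightarrow> (nat \<times> nat \<Rightarrow> nat) \<Rightarrow> nat list" where
  "descent_comp \<alpha> \<tau> = set_to_comp (sum_list \<alpha>) (descent_set \<alpha> \<tau>)"

definition dcoef :: "nat list \<Rightarrow> nat list \<Rightarrow> nat" where
  "dcoef \<alpha> \<beta> = card {\<tau>. SRCT \<alpha> \<tau> \<and> descent_comp \<alpha> \<tau> = \<beta>}"

definition ncs_family :: "nat list \<Rightarrow> nsym" where
  "ncs_family = (THE s.
     (\<forall>\<beta>. composition \<beta> \<longrightarrow>
        ribbon \<beta> = (\<lambda>\<gamma>. \<Sum>\<alpha>\<in>comps (sum_list \<beta>). of_nat (dcoef \<alpha> \<beta>) * s \<alpha> \<gamma>)) \<and>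
     (\<forall>\<alpha>. \<not> composition \<alpha> \<longrightarrow> s \<alpha> = (\<lambda>_. 0)))"

definition ncs :: "nat list \<Rightarrow> nsym" where
  "ncs \<alpha> = ncs_family \<alpha>"

section \<open>Operators on compositions (None represents 0)\<close>

definition dop :: "nat \<Rightarrow> nat list option \<Rightarrow> nat list option" where
  "dop i x = (case x of None \<Rightarrow> None | Some \<alpha> \<Rightarrow>
     (if i \<notin> set \<alpha> then None else
       (let j = Max {j. j < length \<alpha> \<and> \<alpha> ! j = i} in
        Some (if i = 1 then take j \<alpha> @ drop (Suc j) \<alpha> else \<alpha>[j := i - 1]))))"

text \<open>v_[i-1] = d_1 d_2 ... d_(i-1): d_(i-1) applied first.\<close>
definition vop :: "nat \<Rightarrow> nat list option \<Rightarrow> nat list option" where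
  "vop i x = foldl (\<lambda>y j. dop j y) x (rev [1..<i])"

definition aop :: "nat \<Rightarrow> nat list option \<Rightarrow> nat list option" where
  "aop i x = map_option (\<lambda>\<alpha>. \<alpha> @ [i]) x"

definition uop :: "nat \<Rightarrow> nat list option \<Rightarrow> nat list option" where
  "uop i x = aop i (vop i x)"

definition useq :: "nat list \<Rightarrow> nat list \<Rightarrow> nat list option" where
  "useq is \<alpha> = foldl (\<lambda>y i. uop i y) (Some \<alpha>) is"

end

theory Submission
  imports Defs
begin

text \<open>
  Removing the entry 1 from an SRCT identifies SRCTs of shape \<open>\<alpha>\<close> with words \<open>c\<^sub>1 \<dots> c\<^sub>m\<close> (\<open>c\<^sub>j\<close> is the
  column of the entry \<open>j\<close>) such that \<open>t\<^bsub>c\<^sub>1\<^esub> \<cdots> t\<^bsub>c\<^sub>m\<^esub>\<close> maps the empty composition to \<open>\<alpha>\<close>, where \<open>t\<^sub>1\<close> prepends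
  a part 1 and \<open>t\<^sub>c\<close> increases the leftmost part \<open>c - 1\<close>. Hence \<open>h\<^sub>\<beta>\<close> is the sum of \<open>s\<^bsub>t\<^sub>w(\<emptyset>)\<^esub>\<close> over the words
  \<open>w\<close> made of strictly decreasing blocks of lengths \<open>\<beta>\<close>. These expansions are unitriangular for the
  length-lexicographic order, so identities between combinations of the \<open>s\<^sub>\<alpha>\<close> can be checked on the \<open>h\<^sub>\<beta>\<close>.
  In particular \<open>h\<^sub>\<beta> s\<^sub>\<zeta>\<close> is the sum of \<open>s\<^bsub>t\<^sub>w(\<zeta>)\<^esub>\<close> over the same kind of words.

  The operators \<open>u\<^sub>i\<close> and \<open>t\<^sub>c\<close> satisfy a local exchange rule: \<open>u\<^sub>i t\<^sub>c \<alpha> = t\<^sub>c u\<^sub>i \<alpha>\<close>, except that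
  \<open>u\<^bsub>c+1\<^esub> t\<^sub>c \<alpha> = t\<^bsub>c+1\<^esub> u\<^sub>c \<alpha>\<close> if \<open>\<alpha>\<close> has no part \<open>c\<close>. Moving all \<open>u\<close> past all \<open>t\<close> in this way is a bijection
  that preserves the pattern of descents of both words. On the empty composition the only strictly
  increasing (weakly decreasing) index word of length \<open>n\<close> that survives is \<open>1, 2, \<dots>, n\<close>, giving \<open>(n)\<close>
  (respectively \<open>1, \<dots>, 1\<close>, giving \<open>(1\<^sup>n)\<close>). So multiplying \<open>h\<^sub>\<beta>\<close> by \<open>s\<^bsub>(n)\<^esub>\<close> on the right applies these
  \<open>u\<close>-words to each term of its expansion, and by triangularity the same holds for \<open>s\<^sub>\<alpha>\<close>.
\<close>

section \<open>Box-adding operators and their exchange rule\<close>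

fun bump :: "nat \<Rightarrow> nat list \<Rightarrow> nat list option" where
  "bump k [] = None"
| "bump k (x # xs) = (if x = k then Some (Suc k # xs) else map_option ((#) x) (bump k xs))"

definition tbox :: "nat \<Rightarrow> nat list \<Rightarrow> nat list option" where
  "tbox c \<alpha> = (if c = 0 then None else if c = 1 then Some (1 # \<alpha>) else bump (c - 1) \<alpha>)"

text \<open>One pass from the right computes the whole operator \<open>v\<^sub>[\<^sub>i\<^sub>-\<^sub>1\<^sub>]\<close>: the parts that it changes are the
  strict right-to-left maxima among the parts below \<open>i\<close>, and each of them drops to the previous maximum
  (the rightmost one is deleted). The second component is the current maximum; the operator is nonzero if
  and only if that maximum ends up as \<open>i - 1\<close>.\<close>

fun scan :: "nat \<Rightarrow> nat list \<Rightarrow> nat list \<times> nat" where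
  "scan i [] = ([], 0)"
| "scan i (x # xs) = (let (ys, M) = scan i xs in
     if M < x \<and> x < i then (if M = 0 then ys else M # ys, x) else (x # ys, M))"

definition ubox :: "nat \<Rightarrow> nat list \<Rightarrow> nat list option" where
  "ubox i \<alpha> = (if i > 0 \<and> snd (scan i \<alpha>) = i - 1 then Some (fst (scan i \<alpha>) @ [i]) else None)"

text \<open>The last letter of a column word acts first, but the first letter of an index word does.\<close>

fun tword :: "nat list \<Rightarrow> nat list \<Rightarrow> nat list option" where
  "tword [] \<alpha> = Some \<alpha>"
| "tword (c # w) \<alpha> = Option.bind (tword w \<alpha>) (tbox c)"

fun uword :: "nat list \<Rightarrow> nat list \<Rightarrow> nat list option" where
  "uword [] \<alpha> = Some \<alpha>"
| "uword (i # is) \<alpha> = Option.bind (ubox i \<alpha>) (uword is)"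

lemma bump_None_iff: "bump k \<alpha> = None \<longleftrightarrow> k \<notin> set \<alpha>"
  by (induction \<alpha>) auto

lemma count_bump: "bump k \<alpha> = Some \<beta> \<Longrightarrow>
  count_list \<beta> x + (if x = k then 1 else 0) = count_list \<alpha> x + (if x = Suc k then 1 else 0)"
  by (induction \<alpha> arbitrary: \<beta>) (fastforce split: if_splits)+

lemma tbox_eq_None_iff: "tbox c \<alpha> = None \<longleftrightarrow> c = 0 \<or> (c \<noteq> 1 \<and> c - 1 \<notin> set \<alpha>)"
  by (auto simp: tbox_def bump_None_iff)

lemma count_tbox:
  assumes "tbox c \<alpha> = Some \<beta>" "x > 0"
  shows "count_list \<beta> x + (if c = Suc x then 1 else 0) = count_list \<alpha> x + (if x = c then 1 else 0)"
  using assms count_bump[of "c - 1" \<alpha> \<beta> x] by (auto simp: tbox_def split: if_splits)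

lemma scan_less: "i > 0 \<Longrightarrow> snd (scan i \<alpha>) < i"
  by (induction \<alpha>) (auto simp: split_beta)

lemma scan_ge: "x \<in> set \<alpha> \<Longrightarrow> x < i \<Longrightarrow> x \<le> snd (scan i \<alpha>)"
  by (induction \<alpha>) (auto simp: split_beta)

lemma scan_mem: "snd (scan i \<alpha>) = 0 \<or> snd (scan i \<alpha>) \<in> set \<alpha>"
  by (induction \<alpha>) (auto simp: split_beta)

text \<open>Each changed part takes the value of the previous maximum and the rightmost changed part
  is deleted, so the changes telescope: as a multiset, only the final maximum is lost (if it is
  nonzero).\<close>

lemma count_scan:
  "x > 0 \<Longrightarrow> count_list (fst (scan i \<alpha>)) x + (if x = snd (scan i \<alpha>) then 1 else 0) = count_list \<alpha> x"
  by (induction \<alpha>) (auto simp: split_beta)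

lemma scan_eq_iff: "i > 0 \<Longrightarrow> snd (scan i \<alpha>) = i - 1 \<longleftrightarrow> i = 1 \<or> i - 1 \<in> set \<alpha>"
  using scan_less[of i \<alpha>] scan_ge[of "i - 1" \<alpha> i] scan_mem[of i \<alpha>]
  by (cases "i = 1") auto

text \<open>The same condition as in \<open>tbox_eq_None_iff\<close>. Since
  \<open>count_tbox\<close> and \<open>count_ubox\<close> also agree, the two kinds of operators
  differ only in the places of the parts, and questions of definedness reduce to counting
  parts.\<close>

lemma ubox_eq_None_iff: "ubox i \<alpha> = None \<longleftrightarrow> i = 0 \<or> (i \<noteq> 1 \<and> i - 1 \<notin> set \<alpha>)"
  using scan_eq_iff[of i \<alpha>] by (auto simp: ubox_def)

lemma count_ubox:
  assumes "ubox i \<alpha> = Some \<beta>" "x > 0"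
  shows "count_list \<beta> x + (if i = Suc x then 1 else 0) = count_list \<alpha> x + (if x = i then 1 else 0)"
  using assms count_scan[of x i \<alpha>] by (auto simp: ubox_def split: if_splits)

text \<open>While scanning from the right, the bump is either already visible in the output or it is
  still pending in the last removed part.\<close>

lemma scan_bump_above:
  assumes "bump k \<alpha> = Some \<beta>" "0 < k" "Suc k < i" "scan i \<alpha> = (ys, M)"
  shows "(\<exists>zs. scan i \<beta> = (zs, M) \<and> bump k ys = Some zs \<and> k < M) \<or>
         (M = k \<and> scan i \<beta> = (ys, Suc k))"
  using assms
proof (induction \<alpha> arbitrary: \<beta> ys M)
  case Nil
  then show ?case by simp
next
  case (Cons x xs)
  obtain ys0 M0 where s: "scan i xs = (ys0, M0)" by force
  show ?case
  proof (cases "x = k")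
    case True
    then show ?thesis using Cons.prems s by (auto split: if_splits)
  next
    case False
    then obtain \<beta>0 where b: "bump k xs = Some \<beta>0" "\<beta> = x # \<beta>0" using Cons.prems by auto
    from Cons.IH[OF b(1) Cons.prems(2,3) s]
    show ?thesis using Cons.prems False s b by (auto split: if_splits)
  qed
qed

text \<open>The bumped part is at least \<open>i\<close> before and after, so the scan copies it.
  The parts written by the scan are below \<open>i \<le> k\<close>, so they create no part
  \<open>k\<close> further left.\<close>

lemma scan_bump_below:
  assumes "bump k \<alpha> = Some \<beta>" "0 < k" "0 < i" "i \<le> k" "scan i \<alpha> = (ys, M)"
  shows "\<exists>zs. scan i \<beta> = (zs, M) \<and> bump k ys = Some zs"
  using assms
proof (induction \<alpha> arbitrary: \<beta> ys M)
  case Nil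
  then show ?case by simp
next
  case (Cons x xs)
  obtain ys0 M0 where s: "scan i xs = (ys0, M0)" by force
  have "M0 < i" using scan_less[of i xs] s Cons.prems by simp
  show ?case
  proof (cases "x = k")
    case True
    then show ?thesis using Cons.prems s by (auto split: if_splits)
  next
    case False
    then obtain \<beta>0 where b: "bump k xs = Some \<beta>0" "\<beta> = x # \<beta>0" using Cons.prems by auto
    from Cons.IH[OF b(1) Cons.prems(2,3,4) s]
    show ?thesis using Cons.prems False s b \<open>M0 < i\<close> by (auto split: if_splits)
  qed
qed

text \<open>The bumped part becomes \<open>k + 1\<close>, which is out of range for the scan. A
  final maximum \<open>k\<close> must come from another part \<open>k\<close>, to the right of the
  bumped one because \<open>bump\<close> takes the leftmost. So the scan of \<alpha> has already
  reached \<open>k\<close> there and leaves the part to be bumped alone.\<close>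

lemma scan_bump_equal:
  assumes "bump k \<alpha> = Some \<beta>" "0 < k" "scan (Suc k) \<alpha> = (ys, M)"
    "scan (Suc k) \<beta> = (zs, k)"
  shows "M = k \<and> bump k ys = Some zs"
  using assms
proof (induction \<alpha> arbitrary: \<beta> ys M zs)
  case Nil
  then show ?case by simp
next
  case (Cons x xs)
  obtain ys0 M0 where s: "scan (Suc k) xs = (ys0, M0)" by force
  have "M0 < Suc k" using scan_less[of "Suc k" xs] s by simp
  show ?case
  proof (cases "x = k")
    case True
    then show ?thesis using Cons.prems s by (auto split: if_splits)
  next
    case False
    then obtain \<beta>0 where b: "bump k xs = Some \<beta>0" "\<beta> = x # \<beta>0" using Cons.prems by auto
    obtain zs0 N0 where s': "scan (Suc k) \<beta>0 = (zs0, N0)" by force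
    have "N0 = k" using Cons.prems(4) s' b False by (auto split: if_splits)
    with Cons.IH[OF b(1) Cons.prems(2) s, of zs0] s'
    show ?thesis using Cons.prems False s b by (auto split: if_splits)
  qed
qed

lemma bump_append: "k \<in> set xs \<Longrightarrow> bump k (xs @ ys) = map_option (\<lambda>zs. zs @ ys) (bump k xs)"
  by (induction xs) (auto simp: option.map_comp comp_def)

lemma bump_append_notin: "k \<notin> set xs \<Longrightarrow> bump k (xs @ ys) = map_option ((@) xs) (bump k ys)"
  by (cases "bump k ys"; induction xs) auto

lemma scan_Suc_notin: "k \<notin> set \<alpha> \<Longrightarrow> scan (Suc k) \<alpha> = scan k \<alpha>"
  by (induction \<alpha>) (auto simp: split_beta less_Suc_eq)

lemma bump_Some_mem: "bump k xs = Some ys \<Longrightarrow> k \<in> set xs"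
  by (metis bump_None_iff option.distinct(1))

text \<open>The local rule is \<open>u\<^sub>i t\<^sub>c \<alpha> = t\<^sub>c\<^sub>' u\<^sub>i\<^sub>' \<alpha>\<close> for \<open>(c', i') = exch \<alpha> c i\<close>. Its first
  exceptional case only arises on the left-hand side and the second one only on the right-hand side,
  so the same function also describes the inverse.\<close>

definition exch :: "nat list \<Rightarrow> nat \<Rightarrow> nat \<Rightarrow> nat \<times> nat" where
  "exch \<alpha> c i =
     (if (i = Suc c \<and> c \<notin> set \<alpha>) \<or> (c = Suc i \<and> i \<notin> set \<alpha>) then (i, c) else (c, i))"

lemma exch_exch: "exch \<alpha> c i = (c', i') \<Longrightarrow> exch \<alpha> c' i' = (c, i)"
  by (auto simp: exch_def split: if_splits)

text \<open>If the scan leaves the part created by \<open>tbox c\<close> alone, the operators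
  commute. Otherwise this part is the final maximum, so \<open>i = Suc c\<close>, and
  \<open>ubox i\<close> consumes it; the same result arises when \<open>ubox c\<close> appends a
  part \<open>c\<close> and \<open>tbox (Suc c)\<close> raises it.\<close>

lemma exch_forward:
  assumes "tbox c \<alpha> = Some \<beta>" "ubox i \<beta> = Some \<delta>" "exch \<alpha> c i = (c', i')"
  shows "\<exists>\<gamma>. ubox i' \<alpha> = Some \<gamma> \<and> tbox c' \<gamma> = Some \<delta>"
proof -
  have c0: "c > 0" and i0: "i > 0" using assms(1,2) by (auto simp: tbox_def ubox_def split: if_splits)
  obtain ys M where s: "scan i \<alpha> = (ys, M)" by force
  show ?thesis
  proof (cases "c = 1")
    case True
    then have b: "\<beta> = 1 # \<alpha>" using assms(1) by (simp add: tbox_def)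
    show ?thesis
    \<comment> \<open>The exceptional case for \<open>c = 1\<close>: one order deletes the prepended
      1 and appends 2, the other appends 1 and raises it, no other 1 being present.\<close>
    proof (cases "i = 2 \<and> 1 \<notin> set \<alpha>")
      case t: True
      have "scan 1 \<alpha> = (ys, M)" using t s scan_Suc_notin[of 1 \<alpha>] by (simp add: numeral_2_eq_2)
      moreover have M0: "M = 0" using scan_less[of 1 \<alpha>] calculation by simp
      moreover have "\<delta> = ys @ [2]" using assms(2) b s t M0 by (auto simp: ubox_def split: if_splits)
      moreover have "1 \<notin> set ys" using count_scan[of 1 1 \<alpha>] calculation t
        by (simp add: count_list_0_iff)
      ultimately show ?thesis using assms(3) True t
        by (auto simp: exch_def ubox_def tbox_def bump_append_notin)
    next
      case f: False
      then have e: "c' = 1" "i' = i" using assms(3) True i0 by (auto simp: exch_def split: if_splits)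
      have "M \<noteq> 0 \<or> i = 1"
      proof (rule ccontr)
        assume a: "\<not> ?thesis"
        then have "1 \<notin> set \<alpha>" using scan_ge[of 1 \<alpha> i] i0 s by auto
        moreover have "i = 2" using a assms(2) b s by (auto simp: ubox_def split: if_splits)
        ultimately show False using f by simp
      qed
      then show ?thesis using assms(2) b s e
        by (auto simp: ubox_def tbox_def split: if_splits)
    qed
  next
    case False
    define k where "k = c - 1"
    then have k: "c = Suc k" "k > 0" using c0 False by auto
    have bm: "bump k \<alpha> = Some \<beta>" using assms(1) k by (simp add: tbox_def)
    obtain zs where sb: "scan i \<beta> = (zs, i - 1)" and d: "\<delta> = zs @ [i]"
      using assms(2) by (cases "scan i \<beta>") (auto simp: ubox_def split: if_splits)
    \<comment> \<open>In the regular case it suffices that the bump commutes with the scan: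
      \<open>ys\<close> contains \<open>k\<close>, so the bump never reaches the appended part
      \<open>i\<close>.\<close>
    have same: ?thesis if "bump k ys = Some zs" "M = i - 1" "c' = c" "i' = i"
    proof -
      have "tbox c (ys @ [i]) = Some \<delta>"
        using that k d bump_append[of k ys "[i]"] bump_Some_mem by (auto simp: tbox_def)
      then show ?thesis using that s i0 by (auto simp: ubox_def)
    qed
    consider "i \<le> k" | "i = Suc k" | "Suc k < i" by linarith
    then show ?thesis
    proof cases
      case 1
      moreover have "k \<in> set \<alpha>" using bump_Some_mem[OF bm] .
      ultimately have "c' = c \<and> i' = i" using assms(3) k by (auto simp: exch_def split: if_splits)
      then show ?thesis using scan_bump_below[OF bm k(2) i0 \<open>i \<le> k\<close> s] sb same by auto
    next
      case 2
      then have "c' = c \<and> i' = i" using assms(3) k by (auto simp: exch_def split: if_splits)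
      then show ?thesis using scan_bump_equal[of k \<alpha> \<beta> ys M zs] bm k 2 s sb same by auto
    next
      case 3
      from scan_bump_above[OF bm k(2) 3 s] show ?thesis
      proof (elim disjE exE conjE)
        fix zs' assume *: "scan i \<beta> = (zs', M)" "bump k ys = Some zs'" "k < M"
        have "i = Suc c \<longrightarrow> c \<in> set \<alpha>" using * sb k scan_mem[of i \<alpha>] s by auto
        then have "c' = c \<and> i' = i" using assms(3) 3 k by (auto simp: exch_def split: if_splits)
        then show ?thesis using * sb same by auto
      next
        assume *: "M = k" "scan i \<beta> = (ys, Suc k)"
        have i: "i = Suc c" using * sb k i0 3 by auto
        \<comment> \<open>The final maximum of \<alpha> is \<open>k\<close>, so
          \<open>c = k + 1\<close>, being below \<open>i\<close>, cannot be a part of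
          \<alpha>.\<close>
        have nc: "c \<notin> set \<alpha>" using scan_ge[of c \<alpha> i] i s * k by auto
        then have e: "c' = i" "i' = c" using assms(3) i by (auto simp: exch_def)
        have sc: "scan c \<alpha> = (ys, k)" using scan_Suc_notin[OF nc] s * i by simp
        have "c \<notin> set ys" using count_scan[of c i \<alpha>] s nc k i * count_list_0_iff[of \<alpha> c]
          by (auto simp: count_list_0_iff)
        then show ?thesis using e sc k i d sb *
          by (auto simp: ubox_def tbox_def bump_append_notin)
      qed
    qed
  qed
qed

lemma tbox_ex: "c = 1 \<or> (c > 1 \<and> c - 1 \<in> set \<alpha>) \<Longrightarrow> \<exists>\<beta>. tbox c \<alpha> = Some \<beta>"
  using tbox_eq_None_iff[of c \<alpha>] by (cases "tbox c \<alpha>") auto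

lemma ubox_ex: "c = 1 \<or> (c > 1 \<and> c - 1 \<in> set \<alpha>) \<Longrightarrow> \<exists>\<beta>. ubox c \<alpha> = Some \<beta>"
  using ubox_eq_None_iff[of c \<alpha>] by (cases "ubox c \<alpha>") auto

lemma tbox_SomeD: "tbox c \<alpha> = Some \<beta> \<Longrightarrow> c = 1 \<or> (c > 1 \<and> c - 1 \<in> set \<alpha>)"
  using tbox_eq_None_iff[of c \<alpha>] by (cases "c > 1") auto

lemma ubox_SomeD: "ubox c \<alpha> = Some \<beta> \<Longrightarrow> c = 1 \<or> (c > 1 \<and> c - 1 \<in> set \<alpha>)"
  using ubox_eq_None_iff[of c \<alpha>] by (cases "c > 1") auto

lemma mem_count: "x \<in> set xs \<longleftrightarrow> count_list xs x > 0"
  using count_list_0_iff[of xs x] by auto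

text \<open>Counting parts shows that the other side is defined. Its value needs no new computation:
  \<open>exch_forward\<close>, applied to the swapped pair, leads back to \<delta>.\<close>

lemma exch_backward:
  assumes "ubox i \<alpha> = Some \<gamma>" "tbox c \<gamma> = Some \<delta>" "exch \<alpha> c i = (c', i')"
  shows "\<exists>\<beta>. tbox c' \<alpha> = Some \<beta> \<and> ubox i' \<beta> = Some \<delta>"
proof -
  have u: "i = 1 \<or> (i > 1 \<and> i - 1 \<in> set \<alpha>)" using ubox_SomeD[OF assms(1)] .
  have t: "c = 1 \<or> (c > 1 \<and> c - 1 \<in> set \<gamma>)" using tbox_SomeD[OF assms(2)] .
  have "\<exists>\<beta> \<epsilon>. tbox c' \<alpha> = Some \<beta> \<and> ubox i' \<beta> = Some \<epsilon>"
  proof (cases "c = Suc i \<and> i \<notin> set \<alpha>")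
    case True
    then have e: "c' = i" "i' = Suc i" using assms(3) by (auto simp: exch_def)
    obtain \<beta> where b: "tbox i \<alpha> = Some \<beta>" using tbox_ex[OF u] by auto
    have "i \<in> set \<beta>" using count_tbox[OF b, of i] u by (auto simp: mem_count)
    then show ?thesis using ubox_ex[of "Suc i" \<beta>] b e u by auto
  next
    case False
    then have e: "c' = c" "i' = i" using assms(3) u t by (auto simp: exch_def split: if_splits)
    have "c = 1 \<or> (c > 1 \<and> c - 1 \<in> set \<alpha>)"
      using t count_ubox[OF assms(1), of "c - 1"] False by (auto simp: mem_count split: if_splits)
    then obtain \<beta> where b: "tbox c \<alpha> = Some \<beta>" using tbox_ex by blast
    have "i - 1 \<in> set \<beta>" if "i > 1"
    proof (cases "c = i")
      case True
      then show ?thesis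
        using t that count_tbox[OF b, of "i - 1"] count_ubox[OF assms(1), of "i - 1"]
        by (simp add: mem_count)
    next
      case False
      then show ?thesis
        using u that count_tbox[OF b, of "i - 1"] by (simp add: mem_count split: if_splits)
    qed
    then have "i = 1 \<or> (i > 1 \<and> i - 1 \<in> set \<beta>)" using u by blast
    then show ?thesis using ubox_ex[of i \<beta>] b e by auto
  qed
  then obtain \<beta> \<epsilon> where b: "tbox c' \<alpha> = Some \<beta>" "ubox i' \<beta> = Some \<epsilon>" by blast
  from exch_forward[OF this exch_exch[OF assms(3)]] assms(1,2) have "\<epsilon> = \<delta>" by auto
  with b show ?thesis by blast
qed

text \<open>If \<open>tbox c\<close> is defined on \<alpha>, then \<open>c = Suc i\<close> with
  \<open>i > 0\<close> forces \<open>i\<close> to be a part, which rules out the second exceptional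
  case of \<open>exch\<close>.\<close>

lemma exch_cases:
  assumes "tbox c \<alpha> = Some \<beta>" "exch \<alpha> c i = (c', i')" "i > 0"
  obtains "c' = c" "i' = i" | "i = Suc c" "c \<notin> set \<alpha>" "c' = Suc c" "i' = c"
proof (cases "i = Suc c \<and> c \<notin> set \<alpha>")
  case True
  moreover have "c' = Suc c" "i' = c" using True assms(2) by (auto simp: exch_def)
  ultimately show ?thesis using that(2) by blast
next
  case False
  have "\<not> (c = Suc i \<and> i \<notin> set \<alpha>)"
    using tbox_SomeD[OF assms(1)] assms(3) by (elim disjE) auto
  then have "exch \<alpha> c i = (c, i)" using False unfolding exch_def by (metis (full_types))
  then show ?thesis using that(1) assms(2) by simp
qed

lemma tbox_pos: "tbox c \<alpha> = Some \<beta> \<Longrightarrow> c > 0"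
  by (auto dest: tbox_SomeD)

lemma ubox_pos: "ubox c \<alpha> = Some \<beta> \<Longrightarrow> c > 0"
  by (auto dest: ubox_SomeD)

text \<open>An exchange keeps a letter or raises it by one, so only two situations could spoil the
  comparison. If \<open>c1 = Suc c2\<close> and only \<open>c2\<close> were raised, then \<rho>
  would have no part \<open>c2\<close>, although \<open>ubox (Suc c2)\<close> is applied to it. If
  \<open>c1 = c2\<close> and \<open>c1\<close> were raised, then \<nu> would lack the part
  \<open>c2\<close> that was just created.\<close>

lemma exch_pattern_t:
  assumes "tbox c2 \<mu> = Some \<nu>" "tbox c1 \<nu> = Some \<rho>" "ubox i \<rho> = Some \<delta>"
    "exch \<nu> c1 i = (c1', i1)" "exch \<mu> c2 i1 = (c2', i2)"
  shows "c1 \<le> c2 \<longleftrightarrow> c1' \<le> c2'"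
proof -
  have pos: "c1 > 0" "c2 > 0" "i > 0" using assms tbox_pos ubox_pos by blast+
  have i1: "i1 > 0" using assms(2,4) pos by (auto simp: exch_def split: if_splits)
  show ?thesis using assms(2,4) pos(3)
  proof (cases rule: exch_cases)
    case 1
    note first = this
    show ?thesis using assms(1,5) i1
    proof (cases rule: exch_cases)
      case 2
      have "c1 \<noteq> Suc c2"
      proof
        assume c1: "c1 = Suc c2"
        then have "count_list \<rho> c2 = 0"
          using count_tbox[OF assms(1) pos(2)] count_tbox[OF assms(2) pos(2)] 2
          by (simp add: count_list_0_iff[symmetric] split: if_splits)
        then show False using ubox_SomeD[OF assms(3)] 2 first pos by (simp add: count_list_0_iff)
      qed
      then show ?thesis using 2 first by auto
    qed (use first in simp)
  next
    case 2
    note first = this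
    have "c2 \<in> set \<nu>" using count_tbox[OF assms(1) pos(2)] by (simp add: mem_count)
    then have "c1 \<noteq> c2" using 2 by auto
    show ?thesis using assms(1,5) i1
      by (cases rule: exch_cases) (use first \<open>c1 \<noteq> c2\<close> in auto)
  qed
qed

text \<open>The counterpart for two indices, each kept or lowered by one. Lowering only
  \<open>j = Suc i\<close> would require \<open>i\<close> to be absent from \<open>\<mu>1\<close>,
  where it was just appended. Lowering \<open>i = Suc c\<close> uses up the only part
  \<open>c\<close>, so \<open>j = i\<close> would give zero.\<close>

lemma exch_pattern_u:
  assumes "tbox c \<mu> = Some \<nu>" "ubox i \<nu> = Some \<rho>" "ubox j \<rho> = Some \<delta>"
    "exch \<mu> c i = (c1, i1)" "ubox i1 \<mu> = Some \<mu>1" "exch \<mu>1 c1 j = (c2, j1)"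
  shows "i < j \<longleftrightarrow> i1 < j1"
proof -
  have pos: "c > 0" "i > 0" "j > 0" using assms tbox_pos ubox_pos by blast+
  obtain \<epsilon> where e: "tbox c1 \<mu>1 = Some \<epsilon>" using exch_forward[OF assms(1,2,4)] assms(5) by auto
  show ?thesis using assms(1,4) pos(2)
  proof (cases rule: exch_cases)
    case 1
    note first = this
    have "i \<in> set \<mu>1" using count_ubox[OF assms(5), of i1] first pos by (simp add: mem_count)
    show ?thesis using e assms(6) pos(3)
      by (cases rule: exch_cases) (use first \<open>i \<in> set \<mu>1\<close> in \<open>auto simp: less_Suc_eq\<close>)
  next
    case 2
    note first = this
    have "j \<noteq> i"
    proof
      assume "j = i"
      have "count_list \<rho> c = 0"
        using count_tbox[OF assms(1) pos(1)] count_ubox[OF assms(2) pos(1)] 2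
        by (simp add: count_list_0_iff[symmetric] split: if_splits)
      then show False using ubox_SomeD[OF assms(3)] 2 \<open>j = i\<close> pos by (simp add: count_list_0_iff)
    qed
    show ?thesis using e assms(6) pos(3)
      by (cases rule: exch_cases) (use first \<open>j \<noteq> i\<close> in auto)
  qed
qed

section \<open>Moving whole words past each other\<close>

fun tcross :: "nat list \<Rightarrow> nat list \<Rightarrow> nat \<Rightarrow> nat list \<times> nat" where
  "tcross \<alpha> [] i = ([], i)"
| "tcross \<alpha> (c # w) i = (let (c', i1) = exch (the (tword w \<alpha>)) c i; (w', i2) = tcross \<alpha> w i1
     in (c' # w', i2))"

text \<open>The inverse of \<open>tcross\<close>. It begins with the letter that acts first, so that
  the restored tail \<open>w'\<close> is known when the composition on which the next exchange takes
  place has to be computed.\<close>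

fun ucross :: "nat list \<Rightarrow> nat list \<Rightarrow> nat \<Rightarrow> nat list \<times> nat" where
  "ucross \<alpha> [] i = ([], i)"
| "ucross \<alpha> (c # w) i = (let (w', i1) = ucross \<alpha> w i; (c', i2) = exch (the (tword w' \<alpha>)) c i1
     in (c' # w', i2))"

text \<open>For \<open>(\<le>)\<close> the pattern decides whether a column word splits into
  strictly decreasing blocks; for \<open>(<)\<close> it decides whether an index word is strictly
  increasing or weakly decreasing.\<close>

definition same_pattern :: "(nat \<Rightarrow> nat \<Rightarrow> bool) \<Rightarrow> nat list \<Rightarrow> nat list \<Rightarrow> bool" where
  "same_pattern R xs ys \<longleftrightarrow> length xs = length ys \<and>
     (\<forall>k. Suc k < length xs \<longrightarrow> R (xs ! k) (xs ! Suc k) = R (ys ! k) (ys ! Suc k))"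

lemma same_pattern_Nil [simp]: "same_pattern R [] ys \<longleftrightarrow> ys = []"
  by (auto simp: same_pattern_def)

lemma same_pattern_single [simp]: "same_pattern R [x] [y]"
  by (auto simp: same_pattern_def)

lemma same_pattern_Cons2 [simp]:
  "same_pattern R (x # x' # xs) (y # y' # ys) \<longleftrightarrow> R x x' = R y y' \<and> same_pattern R (x' # xs) (y' # ys)"
  by (auto simp: same_pattern_def nth_Cons split: nat.splits)

lemma same_pattern_length: "same_pattern R xs ys \<Longrightarrow> length xs = length ys"
  by (simp add: same_pattern_def)

lemma tcross_forward:
  assumes "tword w \<alpha> = Some \<beta>" "ubox i \<beta> = Some \<delta>" "tcross \<alpha> w i = (w', i')"
  shows "\<exists>\<gamma>. ubox i' \<alpha> = Some \<gamma> \<and> tword w' \<gamma> = Some \<delta> \<and> ucross \<alpha> w' i' = (w, i)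
    \<and> same_pattern (\<le>) w w'"
  using assms
proof (induction w arbitrary: \<beta> i \<delta> w')
  case Nil
  then show ?case by auto
next
  case (Cons c w)
  obtain \<mu> where m: "tword w \<alpha> = Some \<mu>" "tbox c \<mu> = Some \<beta>"
    using Cons.prems(1) by (auto split: bind_splits)
  obtain c' i1 where e: "exch \<mu> c i = (c', i1)" by force
  obtain w1 i2 where t: "tcross \<alpha> w i1 = (w1, i2)" by force
  have w': "w' = c' # w1" "i' = i2" using Cons.prems(3) m e t by auto
  obtain \<gamma>0 where g: "ubox i1 \<mu> = Some \<gamma>0" "tbox c' \<gamma>0 = Some \<delta>"
    using exch_forward[OF m(2) Cons.prems(2) e] by auto
  have *: "\<exists>\<gamma>. ubox i2 \<alpha> = Some \<gamma> \<and> tword w1 \<gamma> = Some \<gamma>0 \<and> ucross \<alpha> w1 i2 = (w, i1)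
      \<and> same_pattern (\<le>) w w1"
    using Cons.IH[OF m(1) g(1), of w1] t w' by simp
  have "same_pattern (\<le>) (c # w) (c' # w1)"
  proof (cases w)
    case Nil
    then show ?thesis using * by auto
  next
    case (Cons c2 v)
    obtain \<nu> where n: "tword v \<alpha> = Some \<nu>" "tbox c2 \<nu> = Some \<mu>"
      using m Cons by (auto split: bind_splits)
    obtain c2' i3 where e2: "exch \<nu> c2 i1 = (c2', i3)" by force
    have "\<exists>v'. w1 = c2' # v'" using t Cons n e2 by (auto split: prod.splits)
    then show ?thesis using exch_pattern_t[OF n(2) m(2) Cons.prems(2) e e2] * Cons by auto
  qed
  then show ?case using * w' g exch_exch[OF e] m by auto
qed

lemma ucross_forward:
  assumes "ubox i' \<alpha> = Some \<gamma>" "tword w' \<gamma> = Some \<delta>" "ucross \<alpha> w' i' = (w, i)"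
  shows "\<exists>\<beta>. tword w \<alpha> = Some \<beta> \<and> ubox i \<beta> = Some \<delta> \<and> tcross \<alpha> w i = (w', i')"
  using assms
proof (induction w' arbitrary: \<delta> w i)
  case Nil
  then show ?case by auto
next
  case (Cons c' w')
  obtain \<mu> where m: "tword w' \<gamma> = Some \<mu>" "tbox c' \<mu> = Some \<delta>"
    using Cons.prems(2) by (auto split: bind_splits)
  obtain w1 i1 where u: "ucross \<alpha> w' i' = (w1, i1)" by force
  from Cons.IH[OF Cons.prems(1) m(1) u] obtain \<beta>0 where
    b: "tword w1 \<alpha> = Some \<beta>0" "ubox i1 \<beta>0 = Some \<mu>" "tcross \<alpha> w1 i1 = (w', i')" by auto
  obtain c i2 where e: "exch \<beta>0 c' i1 = (c, i2)" by force
  have w: "w = c # w1" "i = i2" using Cons.prems(3) u b e by auto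
  from exch_backward[OF b(2) m(2) e] show ?case using w b exch_exch[OF e] by auto
qed

text \<open>Both indices cross the same letters one after the other, so
  \<open>exch_pattern_u\<close> applies letter by letter. The second index meets the word
  \<open>w1\<close> already changed by the first, over the composition to which \<open>i'\<close>
  has been applied.\<close>

lemma tcross_pattern_u:
  assumes "tword w \<alpha> = Some \<beta>" "ubox i \<beta> = Some \<rho>" "ubox j \<rho> = Some \<delta>"
    "tcross \<alpha> w i = (w1, i')" "tcross (the (ubox i' \<alpha>)) w1 j = (w2, j')"
  shows "i < j \<longleftrightarrow> i' < j'"
  using assms
proof (induction w arbitrary: \<beta> i j \<rho> \<delta> w1 w2 i' j')
  case Nil
  then show ?case by auto
next
  case (Cons c w)
  obtain \<mu> where m: "tword w \<alpha> = Some \<mu>" "tbox c \<mu> = Some \<beta>"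
    using Cons.prems(1) by (auto split: bind_splits)
  obtain c1 i1 where e: "exch \<mu> c i = (c1, i1)" by force
  obtain v1 i2 where t: "tcross \<alpha> w i1 = (v1, i2)" by force
  have w1: "w1 = c1 # v1" "i' = i2" using Cons.prems(4) m e t by auto
  obtain \<mu>1 where g: "ubox i1 \<mu> = Some \<mu>1" "tbox c1 \<mu>1 = Some \<rho>"
    using exch_forward[OF m(2) Cons.prems(2) e] by auto
  from tcross_forward[OF m(1) g(1) t] obtain \<alpha>1 where
    a: "ubox i2 \<alpha> = Some \<alpha>1" "tword v1 \<alpha>1 = Some \<mu>1" by auto
  obtain c2 j1 where e2: "exch \<mu>1 c1 j = (c2, j1)" by force
  obtain v2 j2 where t2: "tcross \<alpha>1 v1 j1 = (v2, j2)" by force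
  have "j' = j2" using Cons.prems(5) w1 a e2 t2 by auto
  obtain \<epsilon> where "ubox j1 \<mu>1 = Some \<epsilon>" using exch_forward[OF g(2) Cons.prems(3) e2] by auto
  then have "i1 < j1 \<longleftrightarrow> i2 < j2" using Cons.IH[OF m(1) g(1) _ t, of j1 \<epsilon> v2 j2] a t2 by simp
  with exch_pattern_u[OF m(2) Cons.prems(2,3) e g(1) e2] show ?case using w1 \<open>j' = j2\<close> by simp
qed

text \<open>The indices cross the column word in the order in which they act. Each crossing changes
  the word, and the emerging index changes the composition underneath it, before the next index
  follows.\<close>

fun tgrid :: "nat list \<Rightarrow> nat list \<Rightarrow> nat list \<Rightarrow> nat list \<times> nat list" where
  "tgrid \<alpha> w [] = (w, [])"
| "tgrid \<alpha> w (i # is) = (let (w1, i') = tcross \<alpha> w i; (w2, is') = tgrid (the (ubox i' \<alpha>)) w1 is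
     in (w2, i' # is'))"

fun ugrid :: "nat list \<Rightarrow> nat list \<Rightarrow> nat list \<Rightarrow> nat list \<times> nat list" where
  "ugrid \<alpha> w [] = (w, [])"
| "ugrid \<alpha> w (i # is) = (let (w1, is') = ugrid (the (ubox i \<alpha>)) w is; (w2, i') = ucross \<alpha> w1 i
     in (w2, i' # is'))"

lemma same_pattern_trans: "same_pattern R xs ys \<Longrightarrow> same_pattern R ys zs \<Longrightarrow> same_pattern R xs zs"
  by (auto simp: same_pattern_def)

text \<open>Together with \<open>ugrid_forward\<close>, this makes \<open>tgrid\<close> and
  \<open>ugrid\<close> mutually inverse bijections between the pairs of words with nonzero result in
  the two orders, for a fixed starting composition.\<close>

lemma tgrid_forward:
  assumes "tword w \<alpha> = Some \<beta>" "uword is \<beta> = Some \<delta>" "tgrid \<alpha> w is = (w', is')"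
  shows "\<exists>\<gamma>. uword is' \<alpha> = Some \<gamma> \<and> tword w' \<gamma> = Some \<delta> \<and> ugrid \<alpha> w' is' = (w, is)
    \<and> same_pattern (\<le>) w w' \<and> same_pattern (<) is is'"
  using assms
proof (induction "is" arbitrary: \<alpha> \<beta> w w' is')
  case Nil
  then show ?case by (auto simp: same_pattern_def)
next
  case (Cons i "is")
  obtain \<rho> where r: "ubox i \<beta> = Some \<rho>" "uword is \<rho> = Some \<delta>"
    using Cons.prems(2) by (auto split: bind_splits)
  obtain w1 i' where t: "tcross \<alpha> w i = (w1, i')" by force
  from tcross_forward[OF Cons.prems(1) r(1) t] obtain \<alpha>1 where
    a: "ubox i' \<alpha> = Some \<alpha>1" "tword w1 \<alpha>1 = Some \<rho>" "ucross \<alpha> w1 i' = (w, i)"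
       "same_pattern (\<le>) w w1" by auto
  obtain w2 is2 where g: "tgrid \<alpha>1 w1 is = (w2, is2)" by force
  have w': "w' = w2" "is' = i' # is2" using Cons.prems(3) t a g by auto
  from Cons.IH[OF a(2) r(2) g] obtain \<gamma> where
    c: "uword is2 \<alpha>1 = Some \<gamma>" "tword w2 \<gamma> = Some \<delta>" "ugrid \<alpha>1 w2 is2 = (w1, is)"
       "same_pattern (\<le>) w1 w2" "same_pattern (<) is is2" by auto
  have "same_pattern (<) (i # is) (i' # is2)"
  proof (cases "is")
    case Nil
    then show ?thesis using c by auto
  next
    case (Cons j js)
    obtain \<epsilon> where "ubox j \<rho> = Some \<epsilon>" using r Cons by (auto split: bind_splits)
    obtain w3 j' where t2: "tcross \<alpha>1 w1 j = (w3, j')" by force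
    have "\<exists>js'. is2 = j' # js'" using g Cons t2 by (auto split: prod.splits)
    then show ?thesis
      using tcross_pattern_u[OF Cons.prems(1) r(1) \<open>ubox j \<rho> = Some \<epsilon>\<close> t] a t2 c Cons by auto
  qed
  then show ?case using w' a c same_pattern_trans[OF a(4) c(4)] by auto
qed

lemma ugrid_forward:
  assumes "uword is' \<alpha> = Some \<gamma>" "tword w' \<gamma> = Some \<delta>" "ugrid \<alpha> w' is' = (w, is)"
  shows "\<exists>\<beta>. tword w \<alpha> = Some \<beta> \<and> uword is \<beta> = Some \<delta> \<and> tgrid \<alpha> w is = (w', is')"
  using assms
proof (induction is' arbitrary: \<alpha> w "is")
  case Nil
  then show ?case by auto
next
  case (Cons i' is')
  obtain \<alpha>1 where r: "ubox i' \<alpha> = Some \<alpha>1" "uword is' \<alpha>1 = Some \<gamma>"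
    using Cons.prems(1) by (auto split: bind_splits)
  obtain w1 is1 where g: "ugrid \<alpha>1 w' is' = (w1, is1)" by force
  obtain w2 i where u: "ucross \<alpha> w1 i' = (w2, i)" by force
  have w: "w = w2" "is = i # is1" using Cons.prems(3) r g u by auto
  from Cons.IH[OF r(2) Cons.prems(2) g] obtain \<beta>1 where
    b: "tword w1 \<alpha>1 = Some \<beta>1" "uword is1 \<beta>1 = Some \<delta>" "tgrid \<alpha>1 w1 is1 = (w', is')" by auto
  from ucross_forward[OF r(1) b(1) u] show ?case using b r w by auto
qed

section \<open>The operators on compositions\<close>

text \<open>The rightmost part \<open>i\<close> is exposed by a splitting whose tail omits
  \<open>i\<close>; this evaluates the \<open>Max\<close> in \<open>dop\<close> once and for
  all.\<close>

lemma dop_append: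
  assumes "i \<notin> set ys"
  shows "dop i (Some (xs @ i # ys)) = Some (if i = 1 then xs @ ys else xs @ (i - 1) # ys)"
proof -
  let ?\<alpha> = "xs @ i # ys"
  have "j \<le> length xs" if "j < length ?\<alpha>" "?\<alpha> ! j = i" for j
  proof (rule ccontr)
    assume a: "\<not> j \<le> length xs"
    then have "?\<alpha> ! j = ys ! (j - Suc (length xs))" by (simp add: nth_append nth_Cons')
    then show False using that a assms nth_mem[of "j - Suc (length xs)" ys] by auto
  qed
  then have "Max {j. j < length ?\<alpha> \<and> ?\<alpha> ! j = i} = length xs"
    by (intro Max_eqI) (auto simp: nth_append)
  then show ?thesis by (simp add: dop_def Let_def)
qed

lemma dop_notin: "i \<notin> set \<alpha> \<Longrightarrow> dop i (Some \<alpha>) = None"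
  by (simp add: dop_def)

lemma dop_None [simp]: "dop i None = None"
  by (simp add: dop_def)

lemma vop_None [simp]: "vop i None = None"
proof -
  have "foldl (\<lambda>y j. dop j y) None js = None" for js by (induction js) auto
  then show ?thesis by (simp add: vop_def)
qed

lemma vop_Suc: "i > 0 \<Longrightarrow> vop (Suc i) x = vop i (dop i x)"
  by (simp add: vop_def)

lemma vop_1: "vop (Suc 0) x = x"
  by (simp add: vop_def)

text \<open>No number lies strictly between \<open>i - 1\<close> and \<open>i\<close>, so every part
  to the left is copied once the maximum is \<open>i - 1\<close>.\<close>

lemma scan_append_max: "i > 0 \<Longrightarrow> snd (scan i ys) = i - 1 \<Longrightarrow> scan i (xs @ ys) = (xs @ fst (scan i ys), i - 1)"
  by (induction xs) (auto simp: split_beta prod_eq_iff)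

lemma scan_1: "scan (Suc 0) \<alpha> = (\<alpha>, 0)"
  by (induction \<alpha>) auto

text \<open>The scan with bound \<open>Suc i\<close> ends its changes at the rightmost part
  \<open>i\<close>, where it writes the previous maximum \<open>N\<close>. Lowering that part to
  \<open>i - 1\<close> first and then scanning with bound \<open>i\<close> writes the same value at
  the same place.\<close>

lemma vop_scan:
  "i > 0 \<Longrightarrow> vop i (Some \<alpha>) = (if snd (scan i \<alpha>) = i - 1 then Some (fst (scan i \<alpha>)) else None)"
proof (induction i arbitrary: \<alpha>)
  case 0
  then show ?case by simp
next
  case (Suc i)
  show ?case
  proof (cases "i = 0")
    case True
    then show ?thesis by (simp add: vop_1 scan_1)
  next
    case False
    then have i: "i > 0" by simp
    show ?thesis
    proof (cases "i \<in> set \<alpha>")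
      case False
      then have "snd (scan (Suc i) \<alpha>) \<noteq> i" using scan_eq_iff[of "Suc i" \<alpha>] i by simp
      then show ?thesis using False i by (simp add: vop_Suc dop_notin)
    next
      case True
      then obtain xs ys where a: "\<alpha> = xs @ i # ys" "i \<notin> set ys"
        using split_list_last by metis
      obtain zs N where s: "scan i ys = (zs, N)" by force
      then have s': "scan (Suc i) ys = (zs, N)" using scan_Suc_notin a by simp
      have N: "N < i" using s scan_less[of i ys] i by simp
      have S: "scan (Suc i) \<alpha> = (xs @ (if N = 0 then zs else N # zs), i)"
        using scan_append_max[of "Suc i" "i # ys" xs] s' N a by simp
      have "scan i (if i = 1 then xs @ ys else xs @ (i - 1) # ys) = (xs @ (if N = 0 then zs else N # zs), i - 1)"
      proof (cases "i = 1")
        case True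
        then show ?thesis using s N by (simp add: scan_1)
      next
        case False
        \<comment> \<open>If \<open>N\<close> is already \<open>i - 1\<close>, the lowered part is
          copied, which agrees with replacing it by \<open>N\<close>.\<close>
        have "scan i ((i - 1) # ys) = (if N = 0 then zs else N # zs, i - 1)"
          using s N False i by (cases "N = i - 1") auto
        then show ?thesis using scan_append_max[of i "(i - 1) # ys" xs] False i by simp
      qed
      then show ?thesis using Suc.IH[OF i, of "if i = 1 then xs @ ys else xs @ (i - 1) # ys"] S a i
        by (simp add: vop_Suc dop_append)
    qed
  qed
qed

lemma uop_ubox: "i > 0 \<Longrightarrow> uop i (Some \<alpha>) = ubox i \<alpha>"
  by (simp add: uop_def aop_def vop_scan ubox_def)

lemma useq_uword:
  assumes "\<forall>i\<in>set is. 0 < i"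
  shows "useq is \<alpha> = uword is \<alpha>"
proof -
  have "uop i None = None" for i by (simp add: uop_def aop_def)
  then have N: "foldl (\<lambda>y i. uop i y) None js = None" for js by (induction js) auto
  show ?thesis using assms
    by (induction "is" arbitrary: \<alpha>) (auto simp: useq_def uop_ubox N split: bind_split)
qed

lemma uword_pos: "uword is \<alpha> \<noteq> None \<Longrightarrow> \<forall>i\<in>set is. 0 < i"
  by (induction "is" arbitrary: \<alpha>) (auto split: bind_splits dest: ubox_pos)

section \<open>Index words that survive on the empty composition\<close>

lemma ubox_singleton: "k > 0 \<Longrightarrow> k < i \<Longrightarrow> ubox i [k] = (if i = Suc k then Some [i] else None)"
  by (auto simp: ubox_def)

lemma ubox_Nil: "ubox i [] = (if i = 1 then Some [1] else None)"
  by (auto simp: ubox_def)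

lemma upt_Suc_Cons: "[k..<Suc (k + n)] = k # [Suc k..<Suc (k + n)]"
  by (simp add: upt_conv_Cons del: upt_Suc)

text \<open>On the single part \<open>k\<close>, the only index above \<open>k\<close> with nonzero
  result is \<open>Suc k\<close>, and it yields the single part \<open>Suc k\<close>. This
  determines the whole word step by step.\<close>

lemma uword_singleton_less:
  "\<lbrakk>uword is [k] \<noteq> None; k > 0; sorted_wrt (<) is; \<forall>i\<in>set is. k < i\<rbrakk> \<Longrightarrow>
     is = [Suc k..<Suc k + length is]"
proof (induction "is" arbitrary: k)
  case Nil
  then show ?case by simp
next
  case (Cons i "is")
  then have i: "i = Suc k" "uword is [Suc k] \<noteq> None"
    by (auto simp: ubox_singleton split: if_splits)
  then have "is = [Suc (Suc k)..<Suc (Suc k) + length is]"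
    using Cons.IH[of "Suc k"] Cons.prems by (simp del: upt_Suc)
  then have "i # is = Suc k # [Suc (Suc k)..<Suc (Suc k) + length is]" using i by simp
  also have "\<dots> = [Suc k..<Suc k + length (i # is)]"
    using upt_Suc_Cons[of "Suc k" "length is"] by (simp del: upt_Suc)
  finally show ?case .
qed

lemma uword_upt_singleton: "k > 0 \<Longrightarrow> uword [Suc k..<Suc k + n] [k] = Some [k + n]"
proof (induction n arbitrary: k)
  case (Suc n)
  have "[Suc k..<Suc k + Suc n] = Suc k # [Suc (Suc k)..<Suc (Suc k) + n]"
    using upt_Suc_Cons[of "Suc k" n] by (simp del: upt_Suc)
  then show ?case using Suc.IH[of "Suc k"] Suc.prems by (simp add: ubox_singleton)
qed simp

lemma uword_less_Nil:
  assumes "n > 0"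
  shows "{is. length is = n \<and> sorted_wrt (<) is \<and> uword is [] \<noteq> None} = {[1..<Suc n]}"
    "uword [1..<Suc n] [] = Some [n]"
proof -
  obtain m where n: "n = Suc m" using assms by (cases n) auto
  have u: "[1..<Suc n] = 1 # [Suc 1..<Suc 1 + m]" using n upt_Suc_Cons[of 1 m] by (simp del: upt_Suc)
  show w: "uword [1..<Suc n] [] = Some [n]"
    unfolding u using uword_upt_singleton[of 1 m] n by (simp add: ubox_Nil)
  have "is = [1..<Suc n]" if h: "length is = n" "sorted_wrt (<) is" "uword is [] \<noteq> None" for "is"
  proof -
    obtain i js where eq: "is = i # js" using h n by (cases "is") auto
    then have i: "i = 1" "uword js [1] \<noteq> None" using h by (auto simp: ubox_Nil split: if_splits)
    then have "js = [Suc 1..<Suc 1 + length js]"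
      using uword_singleton_less[of js 1] h eq by (auto simp del: upt_Suc)
    then have "js = [Suc 1..<Suc 1 + m]" using eq h(1) n by (simp del: upt_Suc)
    then show ?thesis using eq i u by simp
  qed
  then show "{is. length is = n \<and> sorted_wrt (<) is \<and> uword is [] \<noteq> None} = {[1..<Suc n]}"
    using w by (auto simp del: upt_Suc)
qed

lemma uword_replicate: "uword (replicate n 1) \<alpha> = Some (\<alpha> @ replicate n 1)"
  by (induction n arbitrary: \<alpha>) (auto simp: ubox_def scan_1)

text \<open>The first index has to be 1 on the empty composition, and the later ones are positive
  and at most 1.\<close>

lemma uword_ge_Nil:
  "{is. length is = n \<and> sorted_wrt (\<ge>) is \<and> uword is [] \<noteq> None} = {replicate n 1}"
proof -
  have "is = replicate n 1" if "length is = n" "sorted_wrt (\<ge>) is" "uword is [] \<noteq> None" for "is"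
  proof (cases "is")
    case (Cons i js)
    then have "i = 1" using that by (auto simp: ubox_Nil split: if_splits)
    then have "\<forall>x\<in>set is. x \<le> 1" using that Cons by auto
    then have "\<forall>x\<in>set is. x = 1" using uword_pos[OF that(3)] by force
    then show ?thesis using replicate_eqI[of "is" n 1] that by blast
  qed (use that in simp)
  moreover have "sorted_wrt (\<ge>) (replicate n (1::nat))" by (induction n) auto
  ultimately show ?thesis by (auto simp: uword_replicate[of n, simplified])
qed

section \<open>Column words\<close>

lemma tword_append: "tword (v @ w) \<alpha> = Option.bind (tword w \<alpha>) (tword v)"
  by (induction v) (auto split: bind_split)

lemma sum_list_bump: "bump k \<alpha> = Some \<beta> \<Longrightarrow> sum_list \<beta> = Suc (sum_list \<alpha>)"
  by (induction \<alpha> arbitrary: \<beta>) (auto split: if_splits)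

lemma length_bump: "bump k \<alpha> = Some \<beta> \<Longrightarrow> length \<beta> = length \<alpha>"
  by (induction \<alpha> arbitrary: \<beta>) (auto split: if_splits)

lemma set_bump: "bump k \<alpha> = Some \<beta> \<Longrightarrow> set \<beta> \<subseteq> insert (Suc k) (set \<alpha>)"
  by (induction \<alpha> arbitrary: \<beta>) (fastforce split: if_splits)+

lemma sum_list_tbox: "tbox c \<alpha> = Some \<beta> \<Longrightarrow> sum_list \<beta> = Suc (sum_list \<alpha>)"
  by (auto simp: tbox_def dest: sum_list_bump split: if_splits)

lemma composition_tbox: "tbox c \<alpha> = Some \<beta> \<Longrightarrow> composition \<alpha> \<Longrightarrow> composition \<beta>"
  using set_bump[of "c - 1" \<alpha> \<beta>] by (auto simp: tbox_def composition_def split: if_splits)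

lemma tword_sum: "tword w \<alpha> = Some \<beta> \<Longrightarrow> sum_list \<beta> = sum_list \<alpha> + length w"
  by (induction w arbitrary: \<beta>) (auto split: bind_splits dest: sum_list_tbox)

lemma tword_composition: "tword w \<alpha> = Some \<beta> \<Longrightarrow> composition \<alpha> \<Longrightarrow> composition \<beta>"
  by (induction w arbitrary: \<beta>) (auto split: bind_splits dest: composition_tbox)

lemma tbox_le: "tbox c \<alpha> = Some \<beta> \<Longrightarrow> c \<le> Suc (sum_list \<alpha>)"
  by (drule tbox_SomeD) (auto dest: member_le_sum_list)

lemma tword_letters: "tword w \<alpha> = Some \<beta> \<Longrightarrow> set w \<subseteq> {..sum_list \<alpha> + length w}"
proof (induction w arbitrary: \<beta>)
  case (Cons c w)
  then obtain \<mu> where "tword w \<alpha> = Some \<mu>" "tbox c \<mu> = Some \<beta>" by (auto split: bind_splits)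
  then show ?case using Cons.IH tword_sum tbox_le by fastforce
qed simp

lemma finite_tword: "finite {w. length w = n \<and> tword w \<alpha> \<noteq> None}"
proof (rule finite_subset)
  show "{w. length w = n \<and> tword w \<alpha> \<noteq> None} \<subseteq> {w. set w \<subseteq> {..sum_list \<alpha> + n} \<and> length w = n}"
    using tword_letters by blast
qed (simp add: finite_lists_length_eq)

lemma sum_list_ubox:
  assumes "ubox i \<alpha> = Some \<beta>"
  shows "sum_list \<beta> = Suc (sum_list \<alpha>)"
proof -
  have "sum_list (fst (scan i \<alpha>)) + snd (scan i \<alpha>) = sum_list \<alpha>"
    by (induction \<alpha>) (auto simp: split_beta)
  then show ?thesis using assms by (auto simp: ubox_def split: if_splits)
qed

lemma ubox_le: "ubox i \<alpha> = Some \<beta> \<Longrightarrow> i \<le> Suc (sum_list \<alpha>)"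
  by (drule ubox_SomeD) (auto dest: member_le_sum_list)

lemma uword_letters: "uword is \<alpha> \<noteq> None \<Longrightarrow> set is \<subseteq> {..sum_list \<alpha> + length is}"
proof (induction "is" arbitrary: \<alpha>)
  case (Cons i "is")
  then obtain \<mu> where "ubox i \<alpha> = Some \<mu>" "uword is \<mu> \<noteq> None" by (auto split: bind_splits)
  then show ?case using Cons.IH[of \<mu>] sum_list_ubox ubox_le by fastforce
qed simp

lemma finite_uword: "finite {is. length is = n \<and> uword is \<alpha> \<noteq> None}"
proof (rule finite_subset)
  show "{is. length is = n \<and> uword is \<alpha> \<noteq> None} \<subseteq> {is. set is \<subseteq> {..sum_list \<alpha> + n} \<and> length is = n}"
    using uword_letters by blast
qed (simp add: finite_lists_length_eq)

section \<open>Block words and their unitriangularity\<close>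

fun blocks :: "nat list \<Rightarrow> nat list \<Rightarrow> bool" where
  "blocks [] w \<longleftrightarrow> w = []"
| "blocks (b # bs) w \<longleftrightarrow> b \<le> length w \<and> sorted_wrt (>) (take b w) \<and> blocks bs (drop b w)"

lemma blocks_length: "blocks \<beta> w \<Longrightarrow> length w = sum_list \<beta>"
  by (induction \<beta> arbitrary: w) fastforce+

lemma blocks_append: "blocks \<beta> v \<Longrightarrow> blocks (\<beta> @ \<gamma>) (v @ w) \<longleftrightarrow> blocks \<gamma> w"
  by (induction \<beta> arbitrary: v) auto

lemma blocks_appendE:
  assumes "blocks (\<beta> @ \<gamma>) x"
  obtains v w where "x = v @ w" "blocks \<beta> v" "blocks \<gamma> w"
proof -
  have "\<exists>v w. x = v @ w \<and> blocks \<beta> v \<and> blocks \<gamma> w" using assms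
  proof (induction \<beta> arbitrary: x)
    case (Cons b \<beta>)
    then have "\<exists>v w. drop b x = v @ w \<and> blocks \<beta> v \<and> blocks \<gamma> w" by simp
    then obtain v w where "drop b x = v @ w" "blocks \<beta> v" "blocks \<gamma> w" by blast
    moreover have "x = (take b x @ v) @ w" using calculation by (metis append_assoc append_take_drop_id)
    moreover have "blocks (b # \<beta>) (take b x @ v)" using calculation Cons.prems by auto
    ultimately show ?case by blast
  qed auto
  then show thesis using that by blast
qed

lemma sorted_wrt_greater_iff:
  "sorted_wrt (>) (w :: nat list) \<longleftrightarrow> (\<forall>k. Suc k < length w \<longrightarrow> \<not> w ! k \<le> w ! Suc k)"
  by (subst sorted_wrt_iff_nth_Suc_transp) (auto simp: transp_def not_le)

lemma same_pattern_blocks: "same_pattern (\<le>) w w' \<Longrightarrow> blocks \<beta> w \<longleftrightarrow> blocks \<beta> w'"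
proof (induction \<beta> arbitrary: w w')
  case (Cons b \<beta>)
  have l: "length w = length w'" using Cons.prems by (simp add: same_pattern_def)
  have "same_pattern (\<le>) (drop b w) (drop b w')"
    using Cons.prems by (auto simp: same_pattern_def)
  moreover have "sorted_wrt (>) (take b w) = sorted_wrt (>) (take b w')"
    using Cons.prems l by (auto simp: sorted_wrt_greater_iff same_pattern_def)
  ultimately show ?case using Cons.IH l by simp
qed (auto simp: same_pattern_def)

lemma same_pattern_less: "same_pattern (<) is js \<Longrightarrow> sorted_wrt (<) is \<longleftrightarrow> sorted_wrt (<) js"
  by (simp add: sorted_wrt_iff_nth_Suc_transp same_pattern_def)

lemma same_pattern_ge: "same_pattern (<) is js \<Longrightarrow> sorted_wrt (\<ge>) is \<longleftrightarrow> sorted_wrt (\<ge>) js"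
  by (simp add: sorted_wrt_iff_nth_Suc_transp same_pattern_def transp_def not_less[symmetric])

text \<open>The word that builds the parts of \<gamma> completely, one after the other, from right
  to left. It contributes the diagonal term of the unitriangular expansion.\<close>

definition std_word :: "nat list \<Rightarrow> nat list" where
  "std_word \<gamma> = concat (map (\<lambda>b. rev [1..<Suc b]) \<gamma>)"

text \<open>In order of action the letters increase. Either the next one is \<open>Suc k\<close> and
  raises the first part, or all of them exceed \<open>Suc k\<close> and the first part stays
  \<open>k\<close> from then on.\<close>

lemma tword_run:
  assumes "tword w (k # \<zeta>) = Some \<alpha>" "sorted_wrt (>) w" "\<forall>x\<in>set w. k < x" "k > 0"
  shows "(w = rev [Suc k..<Suc k + length w] \<and> \<alpha> = (k + length w) # \<zeta>) \<or>
    (length \<alpha> = Suc (length \<zeta>) \<and> hd \<alpha> < k + length w)"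
  using assms
proof (induction w arbitrary: k rule: rev_induct)
  case (snoc c w)
  have c: "k < c" "\<forall>x\<in>set w. c < x" "sorted_wrt (>) w" using snoc.prems by (auto simp: sorted_wrt_append)
  obtain \<mu> where m: "tbox c (k # \<zeta>) = Some \<mu>" "tword w \<mu> = Some \<alpha>"
    using snoc.prems(1) by (auto simp: tword_append split: bind_splits)
  show ?case
  proof (cases "c = Suc k")
    case True
    then have "\<mu> = Suc k # \<zeta>" using m snoc.prems by (auto simp: tbox_def)
    moreover have "[Suc k..<Suc k + length (w @ [c])] = Suc k # [Suc (Suc k)..<Suc (Suc k) + length w]"
      using upt_Suc_Cons[of "Suc k" "length w"] by (simp del: upt_Suc)
    ultimately show ?thesis using snoc.IH[of "Suc k"] m c True by auto
  next
    case False
    have "length \<beta> = Suc (length \<zeta>) \<and> hd \<beta> = k" if "tword v (k # \<zeta>) = Some \<beta>" "\<forall>x\<in>set v. Suc k < x" for v \<beta>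
      using that
    proof (induction v arbitrary: \<beta>)
      case (Cons d v)
      then obtain \<nu> where "tword v (k # \<zeta>) = Some \<nu>" "tbox d \<nu> = Some \<beta>" by (auto split: bind_splits)
      then show ?case using Cons by (cases \<nu>) (auto simp: tbox_def split: if_splits dest: length_bump)
    qed auto
    moreover have "\<forall>x\<in>set (w @ [c]). Suc k < x" using c False by auto
    ultimately show ?thesis using snoc.prems(1) by fastforce
  qed
qed auto

text \<open>The letters of a block are distinct, so at most the letter that acts first is 1. If it
  is, a new first part 1 appears and \<open>tword_run\<close> applies; if not, no part is
  added.\<close>

lemma tword_block:
  assumes "tword w \<zeta> = Some \<alpha>" "sorted_wrt (>) w" "length w = b" "b > 0"
  shows "(w = rev [1..<Suc b] \<and> \<alpha> = b # \<zeta>) \<or> length \<alpha> \<le> length \<zeta> \<or>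
    (length \<alpha> = Suc (length \<zeta>) \<and> hd \<alpha> < b)"
proof -
  obtain v c where w: "w = v @ [c]" using assms(3,4) by (cases w rule: rev_cases) auto
  obtain \<mu> where m: "tbox c \<zeta> = Some \<mu>" "tword v \<mu> = Some \<alpha>"
    using assms(1) w by (auto simp: tword_append split: bind_splits)
  have v: "sorted_wrt (>) v" "\<forall>x\<in>set v. c < x" using assms(2) w by (auto simp: sorted_wrt_append)
  show ?thesis
  proof (cases "c = 1")
    case True
    then have "\<mu> = 1 # \<zeta>" using m by (simp add: tbox_def)
    moreover have "[1..<Suc b] = 1 # [Suc 1..<Suc 1 + length v]"
      using w assms(3) upt_Suc_Cons[of 1 "length v"] by (auto simp del: upt_Suc)
    ultimately show ?thesis using tword_run[of v 1 \<zeta> \<alpha>] m v True w assms(3) by auto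
  next
    case False
    then have "\<forall>x\<in>set w. 1 < x" using w v tbox_pos[OF m(1)] by auto
    then have "length \<alpha> = length \<zeta>" using assms(1)
    proof (induction w arbitrary: \<alpha>)
      case (Cons d v)
      then obtain \<nu> where "tword v \<zeta> = Some \<nu>" "tbox d \<nu> = Some \<alpha>" by (auto split: bind_splits)
      then show ?case using Cons by (auto simp: tbox_def split: if_splits dest: length_bump)
    qed auto
    then show ?thesis by simp
  qed
qed

abbreviation shape_less :: "(nat list \<times> nat list) set" where
  "shape_less \<equiv> lenlex less_than"

text \<open>The blocks act from right to left. Each adds at most one part, and a new first part
  reaches its full size \<open>b\<close> only through the standard run. Any deviation makes the
  shape shorter, or lexicographically smaller at equal length.\<close>

lemma blocks_triangular:
  "\<lbrakk>blocks \<gamma> w; tword w [] = Some \<alpha>; composition \<gamma>\<rbrakk> \<Longrightarrow>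
     (\<alpha> = \<gamma> \<and> w = std_word \<gamma>) \<or> (\<alpha>, \<gamma>) \<in> shape_less"
proof (induction \<gamma> arbitrary: w \<alpha>)
  case Nil
  then show ?case by (simp add: std_word_def)
next
  case (Cons b \<gamma>)
  define v u where "v = take b w" "u = drop b w"
  have w: "w = v @ u" "length v = b" "sorted_wrt (>) v" "blocks \<gamma> u" "b > 0" "composition \<gamma>"
    using Cons.prems by (auto simp: v_u_def composition_def)
  obtain \<zeta> where z: "tword u [] = Some \<zeta>" "tword v \<zeta> = Some \<alpha>"
    using Cons.prems(2) w by (auto simp: tword_append split: bind_splits)
  from Cons.IH[OF w(4) z(1) w(6)] have ih: "(\<zeta> = \<gamma> \<and> u = std_word \<gamma>) \<or> (\<zeta>, \<gamma>) \<in> shape_less" .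
  then have len: "length \<zeta> \<le> length \<gamma>" by (auto simp: lenlex_conv)
  from tword_block[OF z(2) w(3,2,5)] show ?case
  proof (elim disjE conjE)
    assume *: "v = rev [1..<Suc b]" "\<alpha> = b # \<zeta>"
    show ?thesis using ih
    proof
      assume "\<zeta> = \<gamma> \<and> u = std_word \<gamma>"
      then show ?thesis using * w by (simp add: std_word_def)
    next
      assume "(\<zeta>, \<gamma>) \<in> shape_less"
      then show ?thesis using * by (auto simp: lenlex_conv)
    qed
  next
    assume "length \<alpha> \<le> length \<zeta>"
    then show ?thesis using len by (auto simp: lenlex_conv)
  next
    assume "length \<alpha> = Suc (length \<zeta>)" "hd \<alpha> < b"
    then show ?thesis using len by (cases \<alpha>) (auto simp: lenlex_conv)
  qed
qed

lemma tword_rev_upt: "k > 0 \<Longrightarrow> tword (rev [Suc k..<Suc k + n]) (k # \<zeta>) = Some ((k + n) # \<zeta>)"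
  by (induction n) (auto simp: tbox_def)

lemma tword_std_word: "composition \<gamma> \<Longrightarrow> tword (std_word \<gamma>) [] = Some \<gamma>"
proof (induction \<gamma>)
  case (Cons b \<gamma>)
  then obtain n where b: "b = Suc n" by (cases b) (auto simp: composition_def)
  have "[1..<Suc b] = 1 # [Suc 1..<Suc 1 + n]" using b upt_Suc_Cons[of 1 n] by (simp del: upt_Suc)
  then show ?case using Cons tword_rev_upt[of 1 n \<gamma>] b
    by (simp add: std_word_def composition_def tword_append tbox_def del: upt_Suc)
qed (simp add: std_word_def)

section \<open>Descent compositions of words: lengths of the maximal strictly decreasing
  runs\<close>

fun dcomp :: "nat list \<Rightarrow> nat list" where
  "dcomp [] = []"
| "dcomp [c] = [1]"
| "dcomp (c # d # w) =
     (if c \<le> d then 1 # dcomp (d # w) else Suc (hd (dcomp (d # w))) # tl (dcomp (d # w)))"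

lemma dcomp_Nil_iff [simp]: "dcomp w = [] \<longleftrightarrow> w = []"
  by (induction w rule: dcomp.induct) auto

lemma composition_dcomp: "composition (dcomp w)"
  by (induction w rule: dcomp.induct) (auto simp: composition_def list.set_sel(2))

text \<open>The case \<open>c = 0\<close> cuts off the whole first run, the case
  \<open>c > 0\<close> cuts inside it. Both occur when ribbons are multiplied by a single
  generator.\<close>

lemma dcomp_split:
  "dcomp x = (b + c) # bs \<Longrightarrow> b > 0 \<Longrightarrow>
    b \<le> length x \<and> sorted_wrt (>) (take b x) \<and> dcomp (drop b x) = (if c = 0 then bs else c # bs)"
proof (induction x arbitrary: b rule: dcomp.induct)
  case 1
  then show ?case by simp
next
  case (2 a)
  then show ?case by (cases b) auto
next
  case (3 a d w)
  obtain e es where e: "dcomp (d # w) = e # es" using dcomp_Nil_iff by (cases "dcomp (d # w)") auto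
  have "e > 0" using composition_dcomp[of "d # w"] e by (simp add: composition_def)
  obtain b' where b: "b = Suc b'" using "3.prems"(2) by (cases b) auto
  show ?case
  proof (cases "a \<le> d \<or> b' = 0")
    case True
    then show ?thesis using "3.prems"(1) e b \<open>e > 0\<close> by (auto split: if_splits)
  next
    case False
    then have "dcomp (d # w) = (b' + c) # bs" "b' > 0" using "3.prems"(1) e b by auto
    from "3.IH"(2)[OF _ this] False have ih: "b' \<le> length (d # w)" "sorted_wrt (>) (take b' (d # w))"
      "dcomp (drop b' (d # w)) = (if c = 0 then bs else c # bs)" by blast+
    obtain b'' where "b' = Suc b''" using False by (cases b') auto
    then show ?thesis using ih b False by auto
  qed
qed

text \<open>Everything depends on the junction: a weak ascent there starts a new run, a strict
  decrease merges \<open>v\<close> with the first run of \<open>w\<close>.\<close>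

lemma dcomp_append:
  "\<lbrakk>v \<noteq> []; sorted_wrt (>) v; dcomp w = c # bs\<rbrakk> \<Longrightarrow>
     dcomp (v @ w) = length v # c # bs \<or> dcomp (v @ w) = (length v + c) # bs"
proof (induction v rule: dcomp.induct)
  case 1
  then show ?case by simp
next
  case (2 a)
  then obtain d u where "w = d # u" by (cases w) auto
  then show ?case using 2 by auto
next
  case (3 a d v)
  then show ?case by auto
qed

lemma dcomp_sorted: "v \<noteq> [] \<Longrightarrow> sorted_wrt (>) v \<Longrightarrow> dcomp v = [length v]"
  by (induction v rule: dcomp.induct) auto

lemma dcomp_blocks: "dcomp w = \<beta> \<Longrightarrow> blocks \<beta> w"
proof (induction \<beta> arbitrary: w)
  case (Cons b \<beta>)
  have "b > 0" using composition_dcomp[of w] Cons.prems by (simp add: composition_def)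
  then show ?case using dcomp_split[of w b 0 \<beta>] Cons by simp
qed simp

text \<open>Each block ends with the letter 1 and the next one begins with a positive letter, so
  every block boundary is a weak ascent.\<close>

lemma dcomp_std_word: "composition \<gamma> \<Longrightarrow> dcomp (std_word \<gamma>) = \<gamma>"
proof (induction \<gamma>)
  case (Cons b \<gamma>)
  have b: "b > 0" "composition \<gamma>" using Cons.prems by (auto simp: composition_def)
  let ?v = "rev [1..<Suc b]"
  have v: "?v \<noteq> []" "sorted_wrt (>) ?v" "length ?v = b" "last ?v = 1"
    using b by (auto simp: sorted_wrt_rev last_rev hd_append simp del: upt_Suc)
  have s: "std_word (b # \<gamma>) = ?v @ std_word \<gamma>" by (simp add: std_word_def)
  have step: "dcomp (u @ d # w) = length u # dcomp (d # w)"
    if "u \<noteq> []" "sorted_wrt (>) u" "last u \<le> d" for u d w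
    using that by (induction u rule: dcomp.induct) auto
  show ?case
  proof (cases "std_word \<gamma>")
    case Nil
    then show ?thesis using Cons.IH[OF b(2)] s v dcomp_sorted[OF v(1,2)] by simp
  next
    case (Cons d w)
    have "d > 0"
    proof -
      have "d \<in> set (std_word \<gamma>)" using Cons by simp
      then show ?thesis by (auto simp: std_word_def)
    qed
    then have "last ?v \<le> d" using v(4) by simp
    then show ?thesis using Cons.IH[OF b(2)] s v step[OF v(1,2), of d w] Cons by simp
  qed
qed (simp add: std_word_def)

section \<open>Standard reverse composition tableaux as column words\<close>

lemma bumpI:
  "\<lbrakk>j < length xs; xs ! j = k; \<forall>i<j. xs ! i \<noteq> k\<rbrakk> \<Longrightarrow> bump k xs = Some (xs[j := Suc k])"
proof (induction xs arbitrary: j)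
  case (Cons x xs)
  show ?case
  proof (cases j)
    case (Suc i)
    then have "bump k xs = Some (xs[i := Suc k])" using Cons.IH[of i] Cons.prems by fastforce
    then show ?thesis using Cons.prems Suc by auto
  qed (use Cons.prems in auto)
qed simp

lemma bumpE:
  assumes "bump k xs = Some ys"
  obtains j where "j < length xs" "xs ! j = k" "\<forall>i<j. xs ! i \<noteq> k" "ys = xs[j := Suc k]"
proof -
  define j where "j = (LEAST j. j < length xs \<and> xs ! j = k)"
  have ex: "\<exists>j. j < length xs \<and> xs ! j = k"
    using bump_Some_mem[OF assms] by (auto simp: in_set_conv_nth)
  have j: "j < length xs" "xs ! j = k" using LeastI_ex[OF ex] unfolding j_def by auto
  moreover have "\<forall>i<j. xs ! i \<noteq> k" using not_less_Least j(1) unfolding j_def by (metis (mono_tags, lifting) dual_order.strict_trans)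
  ultimately show thesis using that bumpI[of j xs k] assms by auto
qed

definition srct_order :: "(nat \<times> nat) set \<Rightarrow> (nat \<times> nat \<Rightarrow> nat) \<Rightarrow> bool" where
  "srct_order D \<tau> \<longleftrightarrow>
     (\<forall>r c. (r, c) \<in> D \<longrightarrow> (r, c + 1) \<in> D \<longrightarrow> \<tau> (r, c) > \<tau> (r, c + 1)) \<and>
     (\<forall>r s. r < s \<longrightarrow> (r, 1) \<in> D \<longrightarrow> (s, 1) \<in> D \<longrightarrow> \<tau> (r, 1) < \<tau> (s, 1)) \<and>
     (\<forall>r s c. r < s \<longrightarrow> (r, c) \<in> D \<longrightarrow> (s, c + 1) \<in> D \<longrightarrow> \<tau> (r, c) > \<tau> (s, c + 1) \<longrightarrow>
        ((r, c + 1) \<in> D \<and> \<tau> (r, c + 1) > \<tau> (s, c + 1)))"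

lemma SRCT_iff: "SRCT \<alpha> \<tau> \<longleftrightarrow> bij_betw \<tau> (diagram \<alpha>) {1..sum_list \<alpha>} \<and>
    (\<forall>x. x \<notin> diagram \<alpha> \<longrightarrow> \<tau> x = 0) \<and> srct_order (diagram \<alpha>) \<tau>"
  unfolding SRCT_def srct_order_def by blast

text \<open>Adding a box in column 1 puts a new row on top, which shifts the old rows down by one.\<close>

definition row_shift :: "nat \<Rightarrow> nat" where
  "row_shift c = (if c = 1 then 1 else 0)"

text \<open>The last three conjuncts, with the condition that the box on the right is missing, are
  what allows the smallest entry in \<open>(q, c)\<close>: they serve the row condition, the first
  column condition and the triple condition, respectively.\<close>

definition new_box :: "nat \<Rightarrow> nat list \<Rightarrow> nat list \<Rightarrow> nat \<Rightarrow> bool" where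
  "new_box c \<alpha> \<beta> q \<longleftrightarrow>
     (\<forall>r k. (r, k) \<in> diagram \<beta> \<longleftrightarrow>
        (\<exists>r'. r = r' + row_shift c \<and> (r', k) \<in> diagram \<alpha>) \<or> (r = q \<and> k = c)) \<and>
     (\<forall>r'. q = r' + row_shift c \<longrightarrow> (r', c) \<notin> diagram \<alpha>) \<and> (q, Suc c) \<notin> diagram \<beta> \<and>
     (\<forall>r. c = 1 \<longrightarrow> (r, 1) \<in> diagram \<beta> \<longrightarrow> q \<le> r) \<and>
     (\<forall>r k. r < q \<longrightarrow> c = Suc k \<longrightarrow> (r, k) \<in> diagram \<beta> \<longrightarrow> (r, c) \<in> diagram \<beta>)"

text \<open>Since \<open>bump\<close> takes the leftmost part \<open>c - 1\<close>, every higher row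
  that reaches column \<open>c - 1\<close> also reaches column \<open>c\<close>.\<close>

lemma new_box_ex:
  assumes "tbox c \<alpha> = Some \<beta>"
  shows "\<exists>q. new_box c \<alpha> \<beta> q"
proof (cases "c = 1")
  case True
  then have b: "\<beta> = 1 # \<alpha>" using assms by (simp add: tbox_def)
  have "(r, k) \<in> diagram \<beta> \<longleftrightarrow> (\<exists>r'. r = r' + 1 \<and> (r', k) \<in> diagram \<alpha>) \<or> (r = 1 \<and> k = 1)" for r k
    using b by (cases r) (auto simp: diagram_def nth_Cons' )
  then have "new_box c \<alpha> \<beta> 1" using True unfolding new_box_def row_shift_def
    by (auto simp: diagram_def)
  then show ?thesis ..
next
  case False
  then have c: "c > 1" "bump (c - 1) \<alpha> = Some \<beta>"
    using assms by (auto simp: tbox_def split: if_splits)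
  obtain j where j: "j < length \<alpha>" "\<alpha> ! j = c - 1" "\<forall>i<j. \<alpha> ! i \<noteq> c - 1" "\<beta> = \<alpha>[j := c]"
    using bumpE[OF c(2)] c(1) by auto
  have D: "(r, k) \<in> diagram \<beta> \<longleftrightarrow> (r, k) \<in> diagram \<alpha> \<or> (r = Suc j \<and> k = c)" for r k
    using j c(1) by (auto simp: diagram_def nth_list_update)
  have "(r, c) \<in> diagram \<beta>" if "r < Suc j" "c = Suc k" "(r, k) \<in> diagram \<beta>" for r k
  proof -
    have r: "1 \<le> r" "\<beta> ! (r - 1) \<ge> k" using that(3) by (auto simp: diagram_def)
    have "\<beta> ! (r - 1) \<ge> c"
    proof (cases "r - 1 = j")
      case True
      then show ?thesis using j by simp
    next
      case False
      then have "r - 1 < j" using that(1) by simp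
      then have "\<alpha> ! (r - 1) \<noteq> k" "\<beta> ! (r - 1) = \<alpha> ! (r - 1)" using j that(2) by auto
      then show ?thesis using r that(2) by simp
    qed
    then show ?thesis using that(3) c(1) by (auto simp: diagram_def)
  qed
  then have "new_box c \<alpha> \<beta> (Suc j)"
    using D False j c(1) unfolding new_box_def row_shift_def by (auto simp: diagram_def nth_list_update)
  then show ?thesis ..
qed

text \<open>All old entries grow by one, so their comparisons are unchanged. Comparisons with the
  new box, which holds the smallest entry, are settled by \<open>new_box\<close>.\<close>

lemma srct_order_new_box:
  assumes nb: "new_box c \<alpha> \<beta> q"
    and tau: "\<And>r k. (r, k) \<in> diagram \<alpha> \<Longrightarrow> \<tau> (r + row_shift c, k) = Suc (\<sigma> (r, k))"
    and pos: "\<And>r k. (r, k) \<in> diagram \<alpha> \<Longrightarrow> \<sigma> (r, k) > 0" and one: "\<tau> (q, c) = 1"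
  shows "srct_order (diagram \<beta>) \<tau> \<longleftrightarrow> srct_order (diagram \<alpha>) \<sigma>"
proof -
  let ?s = "row_shift c"
  have D: "(r, k) \<in> diagram \<beta> \<longleftrightarrow> (\<exists>r'. r = r' + ?s \<and> (r', k) \<in> diagram \<alpha>) \<or> (r = q \<and> k = c)" for r k
    using nb unfolding new_box_def by blast
  have old: "\<And>r'. q = r' + ?s \<Longrightarrow> (r', c) \<notin> diagram \<alpha>" and right: "(q, Suc c) \<notin> diagram \<beta>"
    and first: "\<And>r. c = 1 \<Longrightarrow> (r, 1) \<in> diagram \<beta> \<Longrightarrow> q \<le> r"
    and above: "\<And>r k. r < q \<Longrightarrow> c = Suc k \<Longrightarrow> (r, k) \<in> diagram \<beta> \<Longrightarrow> (r, c) \<in> diagram \<beta>"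
    using nb unfolding new_box_def by blast+
  have gt: "\<tau> (r, k) > 1" if "(r, k) \<in> diagram \<beta>" "(r, k) \<noteq> (q, c)" for r k
    using that D[of r k] tau pos by fastforce
  have ge: "\<tau> (r, k) \<ge> 1" if "(r, k) \<in> diagram \<beta>" for r k
    using gt[OF that] one by (cases "(r, k) = (q, c)") auto
  have emb: "(r + ?s, k) \<in> diagram \<beta>" if "(r, k) \<in> diagram \<alpha>" for r k using that D by blast
  have down: "(r, k) \<in> diagram \<alpha>" if "(r + ?s, k) \<in> diagram \<beta>" "\<tau> (r + ?s, k) > 1" for r k
    using that D[of "r + ?s" k] one by (metis add_right_cancel less_irrefl)
  show ?thesis
  proof
    assume L: "srct_order (diagram \<beta>) \<tau>"
    show "srct_order (diagram \<alpha>) \<sigma>"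
      unfolding srct_order_def
    proof (intro conjI allI impI)
      fix r k assume "(r, k) \<in> diagram \<alpha>" "(r, k + 1) \<in> diagram \<alpha>"
      then show "\<sigma> (r, k + 1) < \<sigma> (r, k)"
        using L emb tau unfolding srct_order_def by (metis Suc_less_eq)
    next
      fix r t assume "(r, 1) \<in> diagram \<alpha>" "(t, 1) \<in> diagram \<alpha>" "r < (t::nat)"
      then show "\<sigma> (r, 1) < \<sigma> (t, 1)"
        using L emb tau unfolding srct_order_def by (metis Suc_less_eq add_less_cancel_right)
    next
      fix r t k assume a: "r < (t::nat)" "(r, k) \<in> diagram \<alpha>" "(t, k + 1) \<in> diagram \<alpha>" "\<sigma> (t, k + 1) < \<sigma> (r, k)"
      then have *: "(r + ?s, k + 1) \<in> diagram \<beta>" "\<tau> (r + ?s, k + 1) > \<tau> (t + ?s, k + 1)"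
        using L emb[OF a(2)] emb[OF a(3)] tau[OF a(2)] tau[OF a(3)]
        unfolding srct_order_def by (metis Suc_less_eq add_less_cancel_right)+
      \<comment> \<open>The box forced by the triple condition has an entry above 1, so it is not
        the new box and belongs to \<alpha>.\<close>
      moreover have "\<tau> (t + ?s, k + 1) > 1" using tau[OF a(3)] pos[OF a(3)] by simp
      ultimately show b: "(r, k + 1) \<in> diagram \<alpha>" using down by simp
      show "\<sigma> (t, k + 1) < \<sigma> (r, k + 1)" using * tau[OF b] tau[OF a(3)] by simp
    qed
  next
    assume R: "srct_order (diagram \<alpha>) \<sigma>"
    show "srct_order (diagram \<beta>) \<tau>"
      unfolding srct_order_def
    proof (intro conjI allI impI)
      fix r k assume a: "(r, k) \<in> diagram \<beta>" "(r, k + 1) \<in> diagram \<beta>"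
      then have ne: "(r, k) \<noteq> (q, c)" using right by auto
      show "\<tau> (r, k + 1) < \<tau> (r, k)"
      proof (cases "(r, k + 1) = (q, c)")
        case True
        then show ?thesis using gt[OF a(1) ne] one by simp
      next
        case False
        then obtain r' where "r = r' + ?s" "(r', k) \<in> diagram \<alpha>" "(r', k + 1) \<in> diagram \<alpha>"
          using a ne D[of r k] D[of r "k + 1"] by auto
        then show ?thesis using R tau unfolding srct_order_def by simp
      qed
    next
      fix r t assume a: "r < (t::nat)" "(r, 1) \<in> diagram \<beta>" "(t, 1) \<in> diagram \<beta>"
      have ne: "(t, 1) \<noteq> (q, c)" using first[OF _ a(2)] a(1) by auto
      show "\<tau> (r, 1) < \<tau> (t, 1)"
      proof (cases "(r, 1) = (q, c)")
        case True
        then show ?thesis using gt[OF a(3) ne] one by simp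
      next
        case False
        obtain t' r' where "t = t' + ?s" "r = r' + ?s" "(r', 1) \<in> diagram \<alpha>" "(t', 1) \<in> diagram \<alpha>"
          using a ne False D[of r 1] D[of t 1] by auto
        then show ?thesis using R tau a(1) unfolding srct_order_def by simp
      qed
    next
      fix r t k assume a: "r < (t::nat)" "(r, k) \<in> diagram \<beta>" "(t, k + 1) \<in> diagram \<beta>" "\<tau> (t, k + 1) < \<tau> (r, k)"
      have ne: "(r, k) \<noteq> (q, c)" using a(4) one ge[OF a(3)] by auto
      have "(r, k + 1) \<in> diagram \<beta> \<and> \<tau> (t, k + 1) < \<tau> (r, k + 1)"
      proof (cases "(t, k + 1) = (q, c)")
        case True
        then have "(r, c) \<in> diagram \<beta>" using above[of r k] a by auto
        moreover have "(r, c) \<noteq> (q, c)" using True a(1) by auto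
        ultimately show ?thesis using gt[of r c] one True by auto
      next
        case False
        then obtain r' t' where *: "r = r' + ?s" "(r', k) \<in> diagram \<alpha>" "t = t' + ?s" "(t', k + 1) \<in> diagram \<alpha>"
          using a ne D[of r k] D[of t "k + 1"] by auto
        moreover have "r' < t'" using a(1) * by simp
        moreover have "\<sigma> (t', k + 1) < \<sigma> (r', k)" using a(4) * tau by simp
        ultimately have "(r', k + 1) \<in> diagram \<alpha>" "\<sigma> (t', k + 1) < \<sigma> (r', k + 1)"
          using R unfolding srct_order_def by blast+
        then show ?thesis using * emb tau by simp
      qed
      then show "(r, k + 1) \<in> diagram \<beta>" "\<tau> (t, k + 1) < \<tau> (r, k + 1)" by auto
    qed
  qed
qed

text \<open>The truncated subtraction in \<open>r - row_shift c\<close> is harmless because row 0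
  lies in no diagram.\<close>

definition add_entry :: "nat \<Rightarrow> nat list \<Rightarrow> nat list \<Rightarrow> (nat \<times> nat \<Rightarrow> nat) \<Rightarrow> nat \<times> nat \<Rightarrow> nat" where
  "add_entry c \<alpha> \<beta> \<sigma> = (\<lambda>(r, k).
     if (r - row_shift c, k) \<in> diagram \<alpha> then Suc (\<sigma> (r - row_shift c, k))
     else if (r, k) \<in> diagram \<beta> then 1 else 0)"

lemma diagram_pos: "(r, k) \<in> diagram \<alpha> \<Longrightarrow> 0 < r"
  by (simp add: diagram_def)

lemma row_shift_le: "row_shift c \<le> 1"
  by (simp add: row_shift_def)

lemma add_entry_emb:
  "(r, k) \<in> diagram \<alpha> \<Longrightarrow> add_entry c \<alpha> \<beta> \<sigma> (r + row_shift c, k) = Suc (\<sigma> (r, k))"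
  by (simp add: add_entry_def)

lemma bij_betw_new_box:
  assumes nb: "new_box c \<alpha> \<beta> q"
    and tau: "\<And>r k. (r, k) \<in> diagram \<alpha> \<Longrightarrow> \<tau> (r + row_shift c, k) = Suc (\<sigma> (r, k))"
    and one: "\<tau> (q, c) = 1"
    and bij: "bij_betw \<sigma> (diagram \<alpha>) {1..m}"
  shows "bij_betw \<tau> (diagram \<beta>) {1..Suc m}"
proof -
  let ?e = "\<lambda>(r, k). (r + row_shift c, k)"
  have D: "diagram \<beta> = ?e ` diagram \<alpha> \<union> {(q, c)}"
    using nb unfolding new_box_def by (fastforce simp: image_iff)
  have "bij_betw (Suc \<circ> \<sigma>) (diagram \<alpha>) (Suc ` {1..m})"
    using bij_betw_trans[OF bij, of Suc "Suc ` {1..m}"] by (simp add: bij_betw_def)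
  moreover have "(Suc \<circ> \<sigma>) x = (\<tau> \<circ> ?e) x" if "x \<in> diagram \<alpha>" for x
    using that tau by (cases x) simp
  ultimately have "bij_betw (\<tau> \<circ> ?e) (diagram \<alpha>) (Suc ` {1..m})"
    using bij_betw_cong by blast
  then have "bij_betw \<tau> (?e ` diagram \<alpha>) (Suc ` {1..m})"
    by (auto simp: bij_betw_def image_comp inj_on_imageI)
  then have "bij_betw \<tau> (?e ` diagram \<alpha> \<union> {(q, c)}) (Suc ` {1..m} \<union> {1})"
    by (rule bij_betw_combine) (use one in \<open>auto simp: bij_betw_def\<close>)
  moreover have "Suc ` {1..m} \<union> {1} = {1..Suc m}" by (auto simp: image_Suc_atLeastAtMost)
  ultimately show ?thesis using D by simp
qed

lemma new_box_notin: "new_box c \<alpha> \<beta> q \<Longrightarrow> (q - row_shift c, c) \<notin> diagram \<alpha>"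
  unfolding new_box_def using row_shift_le[of c] diagram_pos[of "q - row_shift c" c \<alpha>]
  by (metis Nat.le_imp_diff_is_add add.commute le_add_diff_inverse nat_le_linear not_less_zero zero_less_diff diff_is_0_eq)

lemma add_entry_new:
  assumes "new_box c \<alpha> \<beta> q"
  shows "add_entry c \<alpha> \<beta> \<sigma> (q, c) = 1"
proof -
  have "(q, c) \<in> diagram \<beta>" using assms unfolding new_box_def by blast
  then show ?thesis using new_box_notin[OF assms] by (simp add: add_entry_def)
qed

lemma SRCT_pos: "SRCT \<alpha> \<tau> \<Longrightarrow> x \<in> diagram \<alpha> \<Longrightarrow> \<tau> x > 0"
  unfolding SRCT_iff bij_betw_def by force

lemma SRCT_add_entry:
  assumes t: "tbox c \<alpha> = Some \<beta>" and s: "SRCT \<alpha> \<sigma>"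
  shows "SRCT \<beta> (add_entry c \<alpha> \<beta> \<sigma>)"
proof -
  let ?\<tau> = "add_entry c \<alpha> \<beta> \<sigma>"
  obtain q where nb: "new_box c \<alpha> \<beta> q" using new_box_ex[OF t] by blast
  note one = add_entry_new[OF nb]
  have "bij_betw ?\<tau> (diagram \<beta>) {1..sum_list \<beta>}"
    unfolding sum_list_tbox[OF t]
    by (rule bij_betw_new_box[OF nb add_entry_emb one]) (use s in \<open>auto simp: SRCT_iff\<close>)
  moreover have "srct_order (diagram \<beta>) ?\<tau>"
    using srct_order_new_box[of c \<alpha> \<beta> q ?\<tau> \<sigma>] nb add_entry_emb SRCT_pos[OF s] one s
    by (simp add: SRCT_iff)
  moreover have "?\<tau> x = 0" if "x \<notin> diagram \<beta>" for x
  proof -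
    obtain r k where x: "x = (r, k)" by force
    have "(r - row_shift c, k) \<notin> diagram \<alpha>"
    proof
      assume a: "(r - row_shift c, k) \<in> diagram \<alpha>"
      then have "r = (r - row_shift c) + row_shift c" using diagram_pos[OF a] by simp
      then have "(r, k) \<in> diagram \<beta>" using a nb unfolding new_box_def by metis
      then show False using that x by simp
    qed
    then show ?thesis using that x by (simp add: add_entry_def)
  qed
  ultimately show ?thesis by (simp add: SRCT_iff)
qed

section \<open>The bijection between tableaux and column words\<close>

definition col_word :: "nat list \<Rightarrow> (nat \<times> nat \<Rightarrow> nat) \<Rightarrow> nat list" where
  "col_word \<alpha> \<tau> = map (entry_col \<alpha> \<tau>) [1..<Suc (sum_list \<alpha>)]"

lemma entry_col_eq: "SRCT \<alpha> \<tau> \<Longrightarrow> (r, k) \<in> diagram \<alpha> \<Longrightarrow> entry_col \<alpha> \<tau> (\<tau> (r, k)) = k"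
  by (simp add: SRCT_iff entry_col_def bij_betw_def inv_into_f_f)

text \<open>The new entry 1 supplies the first letter. Old entries move up by one, and the shift
  changes rows only, so their columns are kept.\<close>

lemma col_word_add_entry:
  assumes t: "tbox c \<alpha> = Some \<beta>" and s: "SRCT \<alpha> \<sigma>"
  shows "col_word \<beta> (add_entry c \<alpha> \<beta> \<sigma>) = c # col_word \<alpha> \<sigma>"
proof -
  let ?\<tau> = "add_entry c \<alpha> \<beta> \<sigma>"
  obtain q where nb: "new_box c \<alpha> \<beta> q" using new_box_ex[OF t] by blast
  have T: "SRCT \<beta> ?\<tau>" using SRCT_add_entry[OF t s] .
  have "(q, c) \<in> diagram \<beta>" using nb unfolding new_box_def by blast
  then have 1: "entry_col \<beta> ?\<tau> 1 = c"
    using entry_col_eq[OF T, of q c] add_entry_new[OF nb, of \<sigma>] by simp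
  have 2: "entry_col \<beta> ?\<tau> (Suc j) = entry_col \<alpha> \<sigma> j" if "j \<in> {1..sum_list \<alpha>}" for j
  proof -
    have "j \<in> \<sigma> ` diagram \<alpha>" using s that by (simp add: SRCT_iff bij_betw_def)
    then obtain r k where rk: "(r, k) \<in> diagram \<alpha>" "\<sigma> (r, k) = j" by (metis imageE surj_pair)
    have "(r + row_shift c, k) \<in> diagram \<beta>" using rk nb unfolding new_box_def by blast
    then have "entry_col \<beta> ?\<tau> (Suc j) = k"
      using entry_col_eq[OF T, of "r + row_shift c" k] add_entry_emb[OF rk(1)] rk(2) by simp
    then show ?thesis using entry_col_eq[OF s rk(1)] rk(2) by simp
  qed
  have "[1..<Suc (sum_list \<beta>)] = 1 # map Suc [1..<Suc (sum_list \<alpha>)]"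
    using sum_list_tbox[OF t] by (simp add: upt_conv_Cons map_Suc_upt del: upt_Suc)
  then show ?thesis using 1 2 by (auto simp: col_word_def simp del: upt_Suc)
qed

text \<open>The entry 1 ends its row because rows decrease. In column 1 it lies in the top row,
  because the first column increases. In a later column \<open>c\<close>, a higher row of length
  \<open>c - 1\<close> would have a last entry above 1, and the triple condition would force it to
  continue. So the box is exactly the one that \<open>tbox c\<close> adds.\<close>

lemma SRCT_remove_entry:
  assumes s: "SRCT \<beta> \<tau>" and cmp: "composition \<beta>" and "sum_list \<beta> > 0"
  obtains c \<alpha> \<sigma> where "composition \<alpha>" "tbox c \<alpha> = Some \<beta>" "SRCT \<alpha> \<sigma>" "\<tau> = add_entry c \<alpha> \<beta> \<sigma>"
proof -
  have bij: "bij_betw \<tau> (diagram \<beta>) {1..sum_list \<beta>}" and off: "\<And>x. x \<notin> diagram \<beta> \<Longrightarrow> \<tau> x = 0"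
    and ord: "srct_order (diagram \<beta>) \<tau>" using s by (auto simp: SRCT_iff)
  have "1 \<in> \<tau> ` diagram \<beta>" using bij assms(3) by (auto simp: bij_betw_def)
  then obtain p c where p: "(p, c) \<in> diagram \<beta>" "\<tau> (p, c) = 1" by force
  have inj: "x = (p, c)" if "x \<in> diagram \<beta>" "\<tau> x = 1" for x
    using bij that p by (auto simp: bij_betw_def inj_on_def)
  have pos: "\<tau> x > 0" if "x \<in> diagram \<beta>" for x using SRCT_pos[OF s that] .
  have "(p, c + 1) \<notin> diagram \<beta>"
    using ord p pos[of "(p, c + 1)"] unfolding srct_order_def by (metis less_one not_less_iff_gr_or_eq)
  then have pc: "\<beta> ! (p - 1) = c" "1 \<le> p" "p \<le> length \<beta>" "1 \<le> c" using p(1) by (auto simp: diagram_def)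
  obtain \<alpha> where a: "composition \<alpha>" "tbox c \<alpha> = Some \<beta>"
    "\<forall>r. p = r + row_shift c \<longrightarrow> (r, c) \<notin> diagram \<alpha>"
  proof (cases "c = 1")
    case True
    have "p = 1"
    proof (rule ccontr)
      assume "p \<noteq> 1"
      then have "1 < p" using pc by simp
      have "\<beta> ! 0 \<in> set \<beta>" using pc by (intro nth_mem) auto
      then have d: "(1, 1) \<in> diagram \<beta>" using pc cmp by (auto simp: diagram_def composition_def)
      then have "\<tau> (1, 1) < 1" using ord \<open>1 < p\<close> p True unfolding srct_order_def by metis
      then show False using pos[OF d] by simp
    qed
    then obtain \<alpha> where "\<beta> = 1 # \<alpha>" using pc True by (cases \<beta>) auto
    then show thesis using that[of \<alpha>] True \<open>p = 1\<close> cmp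
      by (auto simp: tbox_def composition_def row_shift_def diagram_def)
  next
    case False
    then have c: "c > 1" using pc by simp
    let ?\<alpha> = "\<beta>[p - 1 := c - 1]"
    have len: "p - 1 < length \<beta>" using pc by simp
    have "\<beta> ! i \<noteq> c - 1" if i: "i < p - 1" for i
    proof
      assume bi: "\<beta> ! i = c - 1"
      then have d: "(Suc i, c - 1) \<in> diagram \<beta>" "(Suc i, c) \<notin> diagram \<beta>"
        using i len c by (auto simp: diagram_def)
      have "\<tau> (Suc i, c - 1) \<noteq> 1" using inj[OF d(1)] c by auto
      then have "\<tau> (Suc i, c - 1) > \<tau> (p, c - 1 + 1)" using pos[OF d(1)] p c by simp
      moreover have "Suc i < p" "(p, c - 1 + 1) \<in> diagram \<beta>" using i p c by auto
      ultimately have "(Suc i, c - 1 + 1) \<in> diagram \<beta>"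
        using ord d(1) unfolding srct_order_def by blast
      then show False using d(2) c by simp
    qed
    then have "bump (c - 1) ?\<alpha> = Some (?\<alpha>[p - 1 := Suc (c - 1)])"
      using len by (intro bumpI) auto
    also have "?\<alpha>[p - 1 := Suc (c - 1)] = \<beta>" using pc(1) c list_update_id[of \<beta> "p - 1"] by simp
    finally have "tbox c ?\<alpha> = Some \<beta>" using c by (simp add: tbox_def)
    moreover have "composition ?\<alpha>" using cmp c set_update_subset_insert[of \<beta> "p - 1" "c - 1"]
      by (auto simp: composition_def)
    moreover have "(p, c) \<notin> diagram ?\<alpha>" using len c by (auto simp: diagram_def)
    ultimately show thesis using that[of ?\<alpha>] False by (simp add: row_shift_def)
  qed
  obtain q where nb: "new_box c \<alpha> \<beta> q" using new_box_ex[OF a(2)] by blast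
  have D: "(r, k) \<in> diagram \<beta> \<longleftrightarrow> (\<exists>r'. r = r' + row_shift c \<and> (r', k) \<in> diagram \<alpha>) \<or> (r = q \<and> k = c)" for r k
    using nb unfolding new_box_def by blast
  have q: "q = p" using D[of p c] p(1) a(3) by blast
  \<comment> \<open>Truncation yields 0 outside the diagram; if a position outside \<alpha> is
    shifted onto the new box, it receives \<open>1 - 1 = 0\<close>.\<close>
  define \<sigma> where "\<sigma> = (\<lambda>(r, k). \<tau> (r + row_shift c, k) - 1)"
  have emb: "(r + row_shift c, k) \<in> diagram \<beta>" "\<tau> (r + row_shift c, k) > 1" if "(r, k) \<in> diagram \<alpha>" for r k
  proof -
    show d: "(r + row_shift c, k) \<in> diagram \<beta>" using D that by blast
    have "(r + row_shift c, k) \<noteq> (p, c)" using a(3) that by blast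
    then show "\<tau> (r + row_shift c, k) > 1" using inj[OF d] pos[OF d] by linarith
  qed
  have tau: "\<tau> (r + row_shift c, k) = Suc (\<sigma> (r, k))" if "(r, k) \<in> diagram \<alpha>" for r k
    using emb(2)[OF that] by (simp add: \<sigma>_def)
  have spos: "\<sigma> (r, k) > 0" if "(r, k) \<in> diagram \<alpha>" for r k
    using emb(2)[OF that] by (simp add: \<sigma>_def)
  have one: "\<tau> (q, c) = 1" using p q by simp
  have s_off: "\<sigma> x = 0" if "x \<notin> diagram \<alpha>" for x
  proof -
    obtain r k where x: "x = (r, k)" by force
    have "(r + row_shift c, k) \<notin> diagram \<beta> \<or> (r + row_shift c, k) = (q, c)"
      using D[of "r + row_shift c" k] that x by auto
    then show ?thesis using off one x by (auto simp: \<sigma>_def)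
  qed
  have "bij_betw \<sigma> (diagram \<alpha>) {1..sum_list \<alpha>}"
  proof (rule bij_betw_imageI)
    show "inj_on \<sigma> (diagram \<alpha>)"
    proof (rule inj_onI, clarify)
      fix r k r' k' assume h: "(r, k) \<in> diagram \<alpha>" "(r', k') \<in> diagram \<alpha>" "\<sigma> (r, k) = \<sigma> (r', k')"
      then have "\<tau> (r + row_shift c, k) = \<tau> (r' + row_shift c, k')" using tau by simp
      then have "(r + row_shift c, k) = (r' + row_shift c, k')"
        using inj_onD[OF bij_betw_imp_inj_on[OF bij]] emb(1)[OF h(1)] emb(1)[OF h(2)] by blast
      then show "r = r' \<and> k = k'" by simp
    qed
    show "\<sigma> ` diagram \<alpha> = {1..sum_list \<alpha>}"
    proof (rule set_eqI)
      fix j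
      have "j \<in> \<sigma> ` diagram \<alpha> \<longleftrightarrow> j > 0 \<and> Suc j \<in> \<tau> ` diagram \<beta>"
      proof
        assume "j \<in> \<sigma> ` diagram \<alpha>"
        then obtain r k where "(r, k) \<in> diagram \<alpha>" "j = \<sigma> (r, k)" by auto
        then show "j > 0 \<and> Suc j \<in> \<tau> ` diagram \<beta>" using tau emb(1) spos by (metis imageI)
      next
        assume h: "j > 0 \<and> Suc j \<in> \<tau> ` diagram \<beta>"
        then obtain r k where rk: "(r, k) \<in> diagram \<beta>" "\<tau> (r, k) = Suc j" by (metis imageE surj_pair)
        then have "(r, k) \<noteq> (q, c)" using one h by auto
        then obtain r' where "r = r' + row_shift c" "(r', k) \<in> diagram \<alpha>" using D[of r k] rk(1) by auto
        then show "j \<in> \<sigma> ` diagram \<alpha>" using tau rk(2) by (metis Suc_inject imageI)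
      qed
      then show "j \<in> \<sigma> ` diagram \<alpha> \<longleftrightarrow> j \<in> {1..sum_list \<alpha>}"
        using bij sum_list_tbox[OF a(2)] by (auto simp: bij_betw_def)
    qed
  qed
  moreover have "srct_order (diagram \<alpha>) \<sigma>"
    using srct_order_new_box[OF nb tau spos one] ord by simp
  ultimately have S: "SRCT \<alpha> \<sigma>" using s_off by (simp add: SRCT_iff)
  have "\<tau> (r, k) = add_entry c \<alpha> \<beta> \<sigma> (r, k)" for r k
  proof (cases "(r - row_shift c, k) \<in> diagram \<alpha>")
    case True
    then have "r = (r - row_shift c) + row_shift c" using diagram_pos[OF True] by simp
    then show ?thesis using tau[OF True] True by (simp add: add_entry_def)
  next
    case False
    then show ?thesis
    proof (cases "(r, k) \<in> diagram \<beta>")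
      case True
      then have "(r, k) = (q, c)" using D[of r k] False by auto
      then show ?thesis using add_entry_new[OF nb] one by simp
    qed (use False off in \<open>auto simp: add_entry_def\<close>)
  qed
  then have "\<tau> = add_entry c \<alpha> \<beta> \<sigma>" by auto
  then show thesis using that a S by blast
qed

lemma length_col_word: "length (col_word \<alpha> \<tau>) = sum_list \<alpha>"
  by (simp add: col_word_def del: upt_Suc)

lemma composition_sum_0: "composition \<alpha> \<Longrightarrow> sum_list \<alpha> = 0 \<Longrightarrow> \<alpha> = []"
  by (cases \<alpha>) (auto simp: composition_def)

lemma diagram_Nil [simp]: "diagram [] = {}"
  by (auto simp: diagram_def)

lemma SRCT_Nil: "SRCT [] \<tau> \<longleftrightarrow> \<tau> = (\<lambda>_. 0)"
  by (auto simp: SRCT_iff srct_order_def bij_betw_def)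

text \<open>Removing the entry 1 removes the first letter, which is the one that acts last.\<close>

lemma tword_col_word: "SRCT \<alpha> \<tau> \<Longrightarrow> composition \<alpha> \<Longrightarrow> tword (col_word \<alpha> \<tau>) [] = Some \<alpha>"
proof (induction "sum_list \<alpha>" arbitrary: \<alpha> \<tau>)
  case 0
  then have "\<alpha> = []" using composition_sum_0[of \<alpha>] by simp
  then show ?case by (simp add: col_word_def)
next
  case (Suc m)
  obtain c \<beta> \<sigma> where *: "composition \<beta>" "tbox c \<beta> = Some \<alpha>" "SRCT \<beta> \<sigma>" "\<tau> = add_entry c \<beta> \<alpha> \<sigma>"
    using SRCT_remove_entry[OF Suc.prems] Suc.hyps(2) by (metis zero_less_Suc)
  have "tword (col_word \<beta> \<sigma>) [] = Some \<beta>"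
    using Suc.hyps(1)[of \<beta> \<sigma>] * Suc.hyps(2) sum_list_tbox[OF *(2)] by simp
  then show ?case using * col_word_add_entry[OF *(2,3)] by simp
qed

lemma col_word_surj: "tword w [] = Some \<alpha> \<Longrightarrow> \<exists>\<tau>. SRCT \<alpha> \<tau> \<and> col_word \<alpha> \<tau> = w"
proof (induction w arbitrary: \<alpha>)
  case Nil
  then show ?case by (auto simp: SRCT_Nil col_word_def)
next
  case (Cons c w)
  then obtain \<beta> where b: "tword w [] = Some \<beta>" "tbox c \<beta> = Some \<alpha>" by (auto split: bind_splits)
  then show ?case using Cons.IH[OF b(1)] SRCT_add_entry[OF b(2)] col_word_add_entry[OF b(2)] by metis
qed

text \<open>Equal words give the same removed column, and by \<open>tword_col_word\<close> their
  tails give the same smaller shape, so the induction hypothesis applies to the smaller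
  tableaux.\<close>

lemma col_word_inj:
  "\<lbrakk>SRCT \<alpha> \<tau>; SRCT \<alpha> \<tau>'; composition \<alpha>; col_word \<alpha> \<tau> = col_word \<alpha> \<tau>'\<rbrakk> \<Longrightarrow> \<tau> = \<tau>'"
proof (induction "sum_list \<alpha>" arbitrary: \<alpha> \<tau> \<tau>')
  case 0
  then have "\<alpha> = []" using composition_sum_0[of \<alpha>] by simp
  then show ?case using 0 by (simp add: SRCT_Nil)
next
  case (Suc m)
  obtain c \<beta> \<sigma> where 1: "composition \<beta>" "tbox c \<beta> = Some \<alpha>" "SRCT \<beta> \<sigma>" "\<tau> = add_entry c \<beta> \<alpha> \<sigma>"
    using SRCT_remove_entry[OF Suc.prems(1,3)] Suc.hyps(2) by (metis zero_less_Suc)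
  obtain c' \<beta>' \<sigma>' where 2: "composition \<beta>'" "tbox c' \<beta>' = Some \<alpha>" "SRCT \<beta>' \<sigma>'" "\<tau>' = add_entry c' \<beta>' \<alpha> \<sigma>'"
    using SRCT_remove_entry[OF Suc.prems(2,3)] Suc.hyps(2) by (metis zero_less_Suc)
  have w: "c = c'" "col_word \<beta> \<sigma> = col_word \<beta>' \<sigma>'"
    using Suc.prems(4) 1 2 col_word_add_entry[OF 1(2,3)] col_word_add_entry[OF 2(2,3)] by auto
  then have "\<beta> = \<beta>'" using tword_col_word[OF 1(3,1)] tword_col_word[OF 2(3,1)] by simp
  then have "\<sigma> = \<sigma>'" using Suc.hyps(1)[of \<beta> \<sigma> \<sigma>'] 1 2 w Suc.hyps(2) sum_list_tbox[OF 1(2)] by simp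
  then show ?case using 1 2 w \<open>\<beta> = \<beta>'\<close> by simp
qed

section \<open>Descent sets and descent compositions\<close>

definition diffs :: "nat list \<Rightarrow> nat list" where
  "diffs ps = map (\<lambda>k. ps ! (k + 1) - ps ! k) [0..<length ps - 1]"

lemma diffs_Cons: "diffs (x # y # zs) = (y - x) # diffs (y # zs)"
  by (simp add: diffs_def map_upt_Suc del: upt_Suc)

lemma diffs_map_Suc: "diffs (map Suc ps) = diffs ps"
  by (auto simp: diffs_def)

definition word_descents :: "nat list \<Rightarrow> nat set" where
  "word_descents w = {j. 1 \<le> j \<and> j < length w \<and> w ! (j - 1) \<le> w ! j}"

lemma finite_word_descents: "finite (word_descents w)"
  by (rule finite_subset[of _ "{..<length w}"]) (auto simp: word_descents_def)

lemma word_descents_Cons: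
  "word_descents (c # d # w) = (if c \<le> d then {1} else {}) \<union> Suc ` word_descents (d # w)"
proof (rule set_eqI)
  fix j
  show "j \<in> word_descents (c # d # w) \<longleftrightarrow>
    j \<in> (if c \<le> d then {1} else {}) \<union> Suc ` word_descents (d # w)"
  proof (cases j)
    case (Suc i)
    then show ?thesis by (cases i) (auto simp: word_descents_def image_iff)
  qed (auto simp: word_descents_def)
qed

lemma sorted_list_of_set_Suc_image:
  "finite S \<Longrightarrow> sorted_list_of_set (Suc ` S) = map Suc (sorted_list_of_set S)"
  by (rule sorted_list_of_set_unique[THEN iffD1])
    (auto simp: sorted_wrt_map card_image)

text \<open>Run lengths are the gaps between cut positions. A new first letter shifts all cuts by
  one; a weak ascent adds a cut at 1, and otherwise the first gap grows.\<close>

lemma diffs_word_descents: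
  "w \<noteq> [] \<Longrightarrow> diffs (0 # sorted_list_of_set (word_descents w) @ [length w]) = dcomp w"
proof (induction w rule: dcomp.induct)
  case (2 c)
  have "word_descents [c] = {}" by (auto simp: word_descents_def)
  then show ?case by (simp add: diffs_def)
next
  case (3 c d w)
  let ?S = "word_descents (d # w)" and ?m = "length (d # w)"
  let ?L = "sorted_list_of_set ?S"
  note fin = finite_word_descents[of "d # w"]
  have ih: "diffs (0 # ?L @ [?m]) = dcomp (d # w)" using 3 by (cases "c \<le> d") auto
  show ?case
  proof (cases "c \<le> d")
    case True
    have "0 \<notin> ?S" by (auto simp: word_descents_def)
    then have "sorted_list_of_set (insert 1 (Suc ` ?S)) = 1 # map Suc ?L"
      using fin by (intro sorted_list_of_set_unique[THEN iffD1])
        (auto simp: sorted_wrt_map card_image card_insert_if intro: Suc_lessI gr0I)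
    then have "diffs (0 # sorted_list_of_set (word_descents (c # d # w)) @ [length (c # d # w)])
      = diffs (0 # 1 # map Suc (?L @ [?m]))" using True by (simp add: word_descents_Cons)
    also have "\<dots> = 1 # diffs (map Suc (0 # ?L @ [?m]))" by (simp add: diffs_Cons)
    also have "\<dots> = dcomp (c # d # w)" using True ih by (simp only: diffs_map_Suc dcomp.simps if_True)
    finally show ?thesis .
  next
    case False
    obtain x xs where x: "?L @ [?m] = x # xs" by (cases "?L @ [?m]") auto
    have "diffs (0 # sorted_list_of_set (word_descents (c # d # w)) @ [length (c # d # w)])
      = diffs (0 # map Suc (?L @ [?m]))"
      using False fin by (simp add: word_descents_Cons sorted_list_of_set_Suc_image)
    also have "\<dots> = Suc x # diffs (map Suc (x # xs))" unfolding x by (simp add: diffs_Cons)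
    also have "\<dots> = Suc x # diffs (x # xs)" by (simp only: diffs_map_Suc)
    also have "\<dots> = dcomp (c # d # w)"
    proof -
      have "dcomp (d # w) = x # diffs (x # xs)" using ih unfolding x by (simp add: diffs_Cons)
      then show ?thesis using False by simp
    qed
    finally show ?thesis .
  qed
qed simp

lemma descent_comp_eq: "descent_comp \<alpha> \<tau> = dcomp (col_word \<alpha> \<tau>)"
proof (cases "sum_list \<alpha> = 0")
  case True
  then have "col_word \<alpha> \<tau> = []" using length_col_word[of \<alpha> \<tau>] by (metis length_0_conv)
  then show ?thesis using True by (simp add: descent_comp_def set_to_comp_def)
next
  case False
  have nth: "col_word \<alpha> \<tau> ! k = entry_col \<alpha> \<tau> (Suc k)" if "k < sum_list \<alpha>" for k
    using that by (simp add: col_word_def del: upt_Suc)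
  have "descent_set \<alpha> \<tau> = word_descents (col_word \<alpha> \<tau>)"
    unfolding descent_set_def word_descents_def length_col_word by (auto simp: nth)
  then have "descent_comp \<alpha> \<tau> =
    diffs (0 # sorted_list_of_set (word_descents (col_word \<alpha> \<tau>)) @ [length (col_word \<alpha> \<tau>)])"
    using False by (simp only: descent_comp_def set_to_comp_def diffs_def Let_def length_col_word if_False)
  moreover have "col_word \<alpha> \<tau> \<noteq> []" using False length_col_word[of \<alpha> \<tau>] by auto
  ultimately show ?thesis using diffs_word_descents by simp
qed

lemma dcoef_eq:
  assumes "composition \<alpha>"
  shows "dcoef \<alpha> \<beta> = card {w. tword w [] = Some \<alpha> \<and> dcomp w = \<beta>}"
proof -
  have "bij_betw (col_word \<alpha>) {\<tau>. SRCT \<alpha> \<tau> \<and> descent_comp \<alpha> \<tau> = \<beta>} {w. tword w [] = Some \<alpha> \<and> dcomp w = \<beta>}"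
    unfolding bij_betw_def
  proof
    show "inj_on (col_word \<alpha>) {\<tau>. SRCT \<alpha> \<tau> \<and> descent_comp \<alpha> \<tau> = \<beta>}"
      using col_word_inj assms by (auto intro: inj_onI)
    show "col_word \<alpha> ` {\<tau>. SRCT \<alpha> \<tau> \<and> descent_comp \<alpha> \<tau> = \<beta>} = {w. tword w [] = Some \<alpha> \<and> dcomp w = \<beta>}"
      using tword_col_word[OF _ assms] col_word_surj by (force simp: descent_comp_eq)
  qed
  then show ?thesis unfolding dcoef_def by (rule bij_betw_same_card)
qed

section \<open>Noncommutative Schur functions\<close>

definition shape :: "nat list \<Rightarrow> nat list" where
  "shape w = the (tword w [])"

definition block_words :: "nat list \<Rightarrow> nat list \<Rightarrow> nat list set" where
  "block_words \<beta> \<zeta> = {w. blocks \<beta> w \<and> tword w \<zeta> \<noteq> None}"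

definition descent_words :: "nat list \<Rightarrow> nat list set" where
  "descent_words \<beta> = {w. dcomp w = \<beta> \<and> tword w [] \<noteq> None}"

lemma finite_block_words [simp]: "finite (block_words \<beta> \<zeta>)"
  by (rule finite_subset[OF _ finite_tword[of "sum_list \<beta>" \<zeta>]])
    (auto simp: block_words_def dest: blocks_length)

lemma descent_words_subset: "descent_words \<beta> \<subseteq> block_words \<beta> []"
  by (auto simp: descent_words_def block_words_def dcomp_blocks)

lemma finite_descent_words [simp]: "finite (descent_words \<beta>)"
  using descent_words_subset finite_subset by fastforce

lemma std_word_descent_words: "composition \<gamma> \<Longrightarrow> std_word \<gamma> \<in> descent_words \<gamma>"
  by (simp add: descent_words_def dcomp_std_word tword_std_word)

lemma composition_Nil [simp]: "composition []"
  by (simp add: composition_def)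

lemma shape_comps: "w \<in> block_words \<beta> [] \<Longrightarrow> shape w \<in> comps (sum_list \<beta>)"
  using blocks_length tword_sum tword_composition[of w "[]"]
  by (fastforce simp: block_words_def shape_def comps_def)

lemma finite_comps: "finite (comps m)"
proof (rule finite_subset)
  have "length \<alpha> \<le> sum_list \<alpha>" if "composition \<alpha>" for \<alpha>
    using that by (induction \<alpha>) (auto simp: composition_def)
  then show "comps m \<subseteq> {\<alpha>. set \<alpha> \<subseteq> {..m} \<and> length \<alpha> \<le> m}"
    by (auto simp: comps_def dest: member_le_sum_list)
qed (simp add: finite_lists_length_le)

text \<open>Grouping the descent words by shape turns the tableau counts into group sizes; after
  this, tableaux no longer appear in the defining equations.\<close>

lemma sum_dcoef:
  "(\<Sum>\<alpha>\<in>comps (sum_list \<beta>). of_nat (dcoef \<alpha> \<beta>) * f \<alpha>) = (\<Sum>w\<in>descent_words \<beta>. f (shape w) :: rat)"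
proof -
  have "of_nat (dcoef \<alpha> \<beta>) * f \<alpha> = (\<Sum>w\<in>{w \<in> descent_words \<beta>. shape w = \<alpha>}. f (shape w))"
    if "\<alpha> \<in> comps (sum_list \<beta>)" for \<alpha>
  proof -
    have "{w \<in> descent_words \<beta>. shape w = \<alpha>} = {w. tword w [] = Some \<alpha> \<and> dcomp w = \<beta>}"
      by (auto simp: descent_words_def shape_def)
    moreover have "(\<Sum>w\<in>{w \<in> descent_words \<beta>. shape w = \<alpha>}. f (shape w)) =
      of_nat (card {w \<in> descent_words \<beta>. shape w = \<alpha>}) * f \<alpha>" by simp
    ultimately show ?thesis using that dcoef_eq[of \<alpha> \<beta>] by (simp add: comps_def)
  qed
  then have "(\<Sum>\<alpha>\<in>comps (sum_list \<beta>). of_nat (dcoef \<alpha> \<beta>) * f \<alpha>) =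
    (\<Sum>\<alpha>\<in>comps (sum_list \<beta>). \<Sum>w\<in>{w \<in> descent_words \<beta>. shape w = \<alpha>}. f (shape w))"
    by (rule sum.cong[OF refl])
  also have "\<dots> = (\<Sum>w\<in>descent_words \<beta>. f (shape w))"
    using shape_comps descent_words_subset by (intro sum.group) (auto simp: finite_comps)
  finally show ?thesis .
qed

lemma wf_shape_less: "wf shape_less"
  by (rule wf_lenlex) simp

lemma shape_triangular:
  "w \<in> block_words \<gamma> [] \<Longrightarrow> composition \<gamma> \<Longrightarrow> w \<noteq> std_word \<gamma> \<Longrightarrow> (shape w, \<gamma>) \<in> shape_less"
  using blocks_triangular by (force simp: block_words_def shape_def)

lemma shape_std_word: "composition \<gamma> \<Longrightarrow> shape (std_word \<gamma>) = \<gamma>"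
  by (simp add: shape_def tword_std_word)

text \<open>The sum over \<open>X \<gamma>\<close> contains the value at \<gamma> once, from the
  standard word, and otherwise only values at smaller shapes. Leaving \<open>X\<close> open covers
  both the expansions of the generators and those of the ribbons.\<close>

lemma shape_sums_inj:
  fixes f g :: "nat list \<Rightarrow> 'a::ab_group_add"
  assumes X: "\<And>\<gamma>. composition \<gamma> \<Longrightarrow> std_word \<gamma> \<in> X \<gamma> \<and> X \<gamma> \<subseteq> block_words \<gamma> []"
    and eq: "\<And>\<gamma>. composition \<gamma> \<Longrightarrow> (\<Sum>w\<in>X \<gamma>. f (shape w)) = (\<Sum>w\<in>X \<gamma>. g (shape w))"
  shows "composition \<alpha> \<Longrightarrow> f \<alpha> = g \<alpha>"
proof (induction \<alpha> rule: wf_induct_rule[OF wf_shape_less])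
  case (1 \<gamma>)
  have fin: "finite (X \<gamma>)" using X[OF 1(2)] finite_subset[OF _ finite_block_words] by blast
  have "f (shape w) = g (shape w)" if "w \<in> X \<gamma> - {std_word \<gamma>}" for w
    using 1 that X shape_triangular shape_comps by (fastforce simp: comps_def)
  then have "(\<Sum>w\<in>X \<gamma> - {std_word \<gamma>}. f (shape w)) = (\<Sum>w\<in>X \<gamma> - {std_word \<gamma>}. g (shape w))"
    by simp
  then show ?case
    using eq[OF 1(2)] X[OF 1(2)] fin shape_std_word[OF 1(2)]
    by (simp add: sum.remove[of _ "std_word \<gamma>"])
qed

text \<open>Solves the unitriangular system given by the expansions of \<open>hbasis\<close>. That
  this family also satisfies the ribbon equations is proved separately.\<close>

definition schur :: "nat list \<Rightarrow> nsym" where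
  "schur = wfrec shape_less (\<lambda>f \<gamma>. if composition \<gamma>
     then (\<lambda>x. hbasis \<gamma> x - (\<Sum>w\<in>block_words \<gamma> [] - {std_word \<gamma>}. f (shape w) x)) else (\<lambda>_. 0))"

lemma schur_not_composition: "\<not> composition \<gamma> \<Longrightarrow> schur \<gamma> = (\<lambda>_. 0)"
  by (simp add: schur_def wfrec[OF wf_shape_less])

lemma std_word_block_words: "composition \<gamma> \<Longrightarrow> std_word \<gamma> \<in> block_words \<gamma> []"
  using std_word_descent_words descent_words_subset by blast

lemma hbasis_schur:
  assumes "composition \<gamma>"
  shows "hbasis \<gamma> = (\<lambda>x. \<Sum>w\<in>block_words \<gamma> []. schur (shape w) x)"
proof
  fix x
  have "schur \<gamma> x = hbasis \<gamma> x - (\<Sum>w\<in>block_words \<gamma> [] - {std_word \<gamma>}. cut schur shape_less \<gamma> (shape w) x)"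
    using assms by (subst schur_def, subst wfrec[OF wf_shape_less]) (simp add: schur_def)
  \<comment> \<open>All shapes in this sum are smaller than \<gamma>, so the guard
    \<open>cut\<close> of the recursion disappears.\<close>
  also have "(\<Sum>w\<in>block_words \<gamma> [] - {std_word \<gamma>}. cut schur shape_less \<gamma> (shape w) x) =
    (\<Sum>w\<in>block_words \<gamma> [] - {std_word \<gamma>}. schur (shape w) x)"
    using shape_triangular[OF _ assms] by (intro sum.cong) (auto simp: cut_apply)
  finally show "hbasis \<gamma> x = (\<Sum>w\<in>block_words \<gamma> []. schur (shape w) x)"
    using std_word_block_words[OF assms] shape_std_word[OF assms]
    by (simp add: sum.remove[of _ "std_word \<gamma>"])
qed

lemma nsym_mult_sum_left:
  "nsym_mult (\<lambda>x. \<Sum>a\<in>A. f a x) g = (\<lambda>x. \<Sum>a\<in>A. nsym_mult (f a) g x)"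
  unfolding nsym_mult_def by (subst sum.swap) (simp add: sum_distrib_right)

lemma nsym_mult_sum_right:
  "nsym_mult g (\<lambda>x. \<Sum>a\<in>A. f a x) = (\<lambda>x. \<Sum>a\<in>A. nsym_mult g (f a) x)"
  unfolding nsym_mult_def by (subst sum.swap) (simp add: sum_distrib_left)

text \<open>Only the cut at \<open>length \<beta>\<close> can produce the prefix \<beta>.\<close>

lemma nsym_mult_hbasis_left:
  "nsym_mult (hbasis \<beta>) g \<zeta> = (if take (length \<beta>) \<zeta> = \<beta> then g (drop (length \<beta>) \<zeta>) else 0)"
proof -
  have "nsym_mult (hbasis \<beta>) g \<zeta> = (\<Sum>k\<in>{0..length \<zeta>}.
    if k = length \<beta> then (if take (length \<beta>) \<zeta> = \<beta> then g (drop (length \<beta>) \<zeta>) else 0) else 0)"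
    unfolding nsym_mult_def hbasis_def by (rule sum.cong) auto
  also have "\<dots> = (if take (length \<beta>) \<zeta> = \<beta> then g (drop (length \<beta>) \<zeta>) else 0)"
    by (auto simp: min_def dest: arg_cong[of _ _ length])
  finally show ?thesis .
qed

lemma nsym_mult_hbasis: "nsym_mult (hbasis \<beta>) (hbasis \<gamma>) = hbasis (\<beta> @ \<gamma>)"
proof
  fix \<zeta> :: "nat list"
  have "(take (length \<beta>) \<zeta> = \<beta> \<and> drop (length \<beta>) \<zeta> = \<gamma>) = (\<zeta> = \<beta> @ \<gamma>)"
    by (metis append_eq_conv_conj)
  then show "nsym_mult (hbasis \<beta>) (hbasis \<gamma>) \<zeta> = hbasis (\<beta> @ \<gamma>) \<zeta>"
    by (auto simp: nsym_mult_hbasis_left) (auto simp: hbasis_def)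
qed

lemma composition_append [simp]: "composition (\<beta> @ \<gamma>) \<longleftrightarrow> composition \<beta> \<and> composition \<gamma>"
  by (auto simp: composition_def)

lemma composition_Cons [simp]: "composition (b # \<gamma>) \<longleftrightarrow> 0 < b \<and> composition \<gamma>"
  by (auto simp: composition_def)

text \<open>In \<open>v @ u\<close> the word \<open>u\<close> acts first. Concatenation is injective
  here because every \<open>v\<close> has length \<open>sum_list \<beta>\<close>.\<close>

lemma sum_words_append:
  assumes "finite U" "\<And>u. u \<in> U \<Longrightarrow> tword u [] \<noteq> None"
  shows "(\<Sum>u\<in>U. \<Sum>v\<in>block_words \<beta> (shape u). f (the (tword v (shape u)))) =
    (\<Sum>w\<in>(\<lambda>(u, v). v @ u) ` Sigma U (\<lambda>u. block_words \<beta> (shape u)). f (shape w) :: rat)"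
proof -
  have inj: "inj_on (\<lambda>(u, v). v @ u) (Sigma U (\<lambda>u. block_words \<beta> (shape u)))"
    by (rule inj_onI) (auto simp: block_words_def dest!: blocks_length)
  have "the (tword v (shape u)) = shape (v @ u)" if "u \<in> U" for u v
    using assms(2)[OF that] by (auto simp: shape_def tword_append)
  then have "(\<Sum>u\<in>U. \<Sum>v\<in>block_words \<beta> (shape u). f (the (tword v (shape u)))) =
    (\<Sum>u\<in>U. \<Sum>v\<in>block_words \<beta> (shape u). f (shape (v @ u)))" by simp
  also have "\<dots> = (\<Sum>(u, v)\<in>Sigma U (\<lambda>u. block_words \<beta> (shape u)). f (shape (v @ u)))"
    using assms(1) by (simp add: sum.Sigma)
  also have "\<dots> = (\<Sum>w\<in>(\<lambda>(u, v). v @ u) ` Sigma U (\<lambda>u. block_words \<beta> (shape u)). f (shape w))"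
    by (subst sum.reindex[OF inj]) (simp add: case_prod_unfold)
  finally show ?thesis .
qed

lemma block_words_append:
  "block_words (\<beta> @ \<gamma>) [] = (\<lambda>(u, v). v @ u) ` Sigma (block_words \<gamma> []) (\<lambda>u. block_words \<beta> (shape u))"
proof
  show "block_words (\<beta> @ \<gamma>) [] \<subseteq> (\<lambda>(u, v). v @ u) ` Sigma (block_words \<gamma> []) (\<lambda>u. block_words \<beta> (shape u))"
  proof
    fix x assume "x \<in> block_words (\<beta> @ \<gamma>) []"
    then have x: "blocks (\<beta> @ \<gamma>) x" "tword x [] \<noteq> None" by (auto simp: block_words_def)
    obtain v u where "x = v @ u" "blocks \<beta> v" "blocks \<gamma> u" using blocks_appendE[OF x(1)] .
    then show "x \<in> (\<lambda>(u, v). v @ u) ` Sigma (block_words \<gamma> []) (\<lambda>u. block_words \<beta> (shape u))"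
      using x(2) by (auto simp: block_words_def tword_append shape_def image_iff split: bind_splits)
  qed
qed (auto simp: block_words_def tword_append blocks_append shape_def)

text \<open>Both sides are compared as functions of \<zeta>. Summed over the block words of any
  \<gamma>, both become \<open>hbasis (\<beta> @ \<gamma>)\<close>: the left by multiplicativity,
  the right by concatenating block words.\<close>

lemma hbasis_mult_schur:
  assumes "composition \<beta>" "composition \<zeta>"
  shows "nsym_mult (hbasis \<beta>) (schur \<zeta>) x = (\<Sum>w\<in>block_words \<beta> \<zeta>. schur (the (tword w \<zeta>)) x)"
proof (rule shape_sums_inj[where X = "\<lambda>\<gamma>. block_words \<gamma> []" and \<alpha> = \<zeta>])
  fix \<gamma> assume g: "composition \<gamma>"
  have "(\<Sum>u\<in>block_words \<gamma> []. nsym_mult (hbasis \<beta>) (schur (shape u)) x) = hbasis (\<beta> @ \<gamma>) x"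
    using fun_cong[OF nsym_mult_hbasis, of \<beta> \<gamma> x] hbasis_schur[OF g] by (simp add: nsym_mult_sum_right)
  also have "\<dots> = (\<Sum>w\<in>block_words (\<beta> @ \<gamma>) []. schur (shape w) x)"
    using g assms by (simp add: hbasis_schur)
  also have "\<dots> = (\<Sum>u\<in>block_words \<gamma> []. \<Sum>v\<in>block_words \<beta> (shape u). schur (the (tword v (shape u))) x)"
    unfolding block_words_append
    by (rule sum_words_append[symmetric]) (simp, simp add: block_words_def)
  finally show "(\<Sum>u\<in>block_words \<gamma> []. nsym_mult (hbasis \<beta>) (schur (shape u)) x) =
    (\<Sum>u\<in>block_words \<gamma> []. \<Sum>v\<in>block_words \<beta> (shape u). schur (the (tword v (shape u))) x)" .
qed (use assms std_word_block_words in auto)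

section \<open>Ribbon functions and identification of the Schur family\<close>

lemma coarsens_length: "coarsens \<gamma> \<beta> \<Longrightarrow> length \<gamma> \<le> length \<beta>"
proof -
  have "\<forall>l\<in>set L. l \<noteq> [] \<Longrightarrow> length L \<le> length (concat L)" for L :: "nat list list"
  proof (induction L)
    case (Cons l L)
    then have "1 \<le> length l" by (cases l) auto
    then show ?case using Cons by simp
  qed simp
  then show "coarsens \<gamma> \<beta> \<Longrightarrow> length \<gamma> \<le> length \<beta>" by (auto simp: coarsens_def)
qed

lemma coarsens_hd: "coarsens \<gamma> (b # bs) \<Longrightarrow> \<exists>g \<gamma>'. \<gamma> = g # \<gamma>' \<and> b \<le> g"
  unfolding coarsens_def
proof (elim exE conjE)
  fix L assume L: "\<forall>l\<in>set L. l \<noteq> []" "concat L = b # bs" "map sum_list L = \<gamma>"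
  then obtain l L' where l: "L = l # L'" by (cases L) auto
  then obtain l' where "l = b # l'" using L by (cases l) auto
  then show ?thesis using L l by auto
qed

text \<open>The first group of summands is either \<open>b\<close> alone or begins with
  \<open>b\<close> and \<open>c\<close>, which may then be added beforehand.\<close>

lemma coarsens_Cons2:
  "coarsens \<gamma> (b # c # bs) \<longleftrightarrow>
     (\<exists>\<gamma>'. \<gamma> = b # \<gamma>' \<and> coarsens \<gamma>' (c # bs)) \<or> coarsens \<gamma> ((b + c) # bs)"
proof
  assume "coarsens \<gamma> (b # c # bs)"
  then obtain L where L: "\<forall>l\<in>set L. l \<noteq> []" "concat L = b # c # bs" "map sum_list L = \<gamma>"
    by (auto simp: coarsens_def)
  then obtain l L' where l: "L = l # L'" by (cases L) auto
  then obtain l' where l': "l = b # l'" using L by (cases l) auto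
  show "(\<exists>\<gamma>'. \<gamma> = b # \<gamma>' \<and> coarsens \<gamma>' (c # bs)) \<or> coarsens \<gamma> ((b + c) # bs)"
  proof (cases l')
    case Nil
    then have "coarsens (map sum_list L') (c # bs)" using L l l' unfolding coarsens_def by auto
    then show ?thesis using L l l' Nil by auto
  next
    case (Cons d l'')
    then have "d = c" "concat (((b + c) # l'') # L') = (b + c) # bs" using L l l' by auto
    moreover have "map sum_list (((b + c) # l'') # L') = \<gamma>" using L l l' Cons calculation by auto
    ultimately show ?thesis using L(1) l unfolding coarsens_def
      by (intro disjI2 exI[of _ "((b + c) # l'') # L'"]) auto
  qed
next
  assume "(\<exists>\<gamma>'. \<gamma> = b # \<gamma>' \<and> coarsens \<gamma>' (c # bs)) \<or> coarsens \<gamma> ((b + c) # bs)"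
  then show "coarsens \<gamma> (b # c # bs)"
  proof
    assume "\<exists>\<gamma>'. \<gamma> = b # \<gamma>' \<and> coarsens \<gamma>' (c # bs)"
    then obtain L where "\<forall>l\<in>set L. l \<noteq> []" "concat L = c # bs" "\<gamma> = b # map sum_list L"
      by (auto simp: coarsens_def)
    then show ?thesis unfolding coarsens_def by (intro exI[of _ "[b] # L"]) auto
  next
    assume "coarsens \<gamma> ((b + c) # bs)"
    then obtain L where L: "\<forall>l\<in>set L. l \<noteq> []" "concat L = (b + c) # bs" "\<gamma> = map sum_list L"
      by (auto simp: coarsens_def)
    then obtain l L' where l: "L = l # L'" by (cases L) auto
    then obtain l' where "l = (b + c) # l'" using L by (cases l) auto
    then show ?thesis using L l unfolding coarsens_def
      by (intro exI[of _ "(b # c # l') # L'"]) auto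
  qed
qed

text \<open>Coarsenings that keep \<open>b\<close> separate and those that merge it with
  \<open>c\<close> are disjoint, since merging makes the first part larger than \<open>b\<close>.
  The merged ones change sign because the fine composition has one part more.\<close>

lemma ribbon_Cons2:
  assumes "0 < c"
  shows "ribbon (b # c # bs) \<gamma> = nsym_mult (hbasis [b]) (ribbon (c # bs)) \<gamma> - ribbon ((b + c) # bs) \<gamma>"
proof -
  have ex: "\<not> coarsens (b # \<gamma>') ((b + c) # bs)" for \<gamma>' using coarsens_hd assms by fastforce
  show ?thesis
  proof (cases "\<exists>\<gamma>'. \<gamma> = b # \<gamma>'")
    case True
    then show ?thesis using ex by (auto simp: ribbon_def nsym_mult_hbasis_left coarsens_Cons2)
  next
    case False
    then have "take 1 \<gamma> \<noteq> [b]" by (cases \<gamma>) auto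
    moreover have "coarsens \<gamma> (b # c # bs) \<longleftrightarrow> coarsens \<gamma> ((b + c) # bs)"
      using False coarsens_Cons2 by auto
    ultimately show ?thesis using coarsens_length[of \<gamma> "(b + c) # bs"]
      by (auto simp: ribbon_def nsym_mult_hbasis_left Suc_diff_le)
  qed
qed

lemma coarsens_Nil: "coarsens \<gamma> [] \<longleftrightarrow> \<gamma> = []"
  using coarsens_length[of \<gamma> "[]"] by (auto simp: coarsens_def)

lemma coarsens_single: "coarsens \<gamma> [b] \<longleftrightarrow> \<gamma> = [b]"
proof
  assume "coarsens \<gamma> [b]"
  then obtain L where L: "\<forall>l\<in>set L. l \<noteq> []" "concat L = [b]" "\<gamma> = map sum_list L"
    by (auto simp: coarsens_def)
  then obtain l L' where l: "L = l # L'" by (cases L) auto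
  then have "l = [b]" "concat L' = []" using L by (auto simp: append_eq_Cons_conv)
  moreover have "L' = []" using L(1) l calculation by (cases L') auto
  ultimately show "\<gamma> = [b]" using L l by simp
next
  assume "\<gamma> = [b]"
  then show "coarsens \<gamma> [b]" unfolding coarsens_def by (intro exI[of _ "[[b]]"]) simp
qed

text \<open>The analogue of \<open>ribbon_Cons2\<close> for words: the junction of a decreasing
  block with the next run is either a weak ascent or a strict decrease.\<close>

lemma descent_words_Cons2:
  assumes "0 < b" "0 < c"
  shows "(\<lambda>(u, v). v @ u) ` Sigma (descent_words (c # bs)) (\<lambda>u. block_words [b] (shape u)) =
    descent_words (b # c # bs) \<union> descent_words ((b + c) # bs)" (is "?L = ?R")
proof
  show "?L \<subseteq> ?R"
  proof (clarify)
    fix u v assume u: "u \<in> descent_words (c # bs)" and v: "v \<in> block_words [b] (shape u)"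
      and n: "v @ u \<notin> descent_words ((b + c) # bs)"
    have l: "length v = b" "sorted_wrt (>) v" using v by (auto simp: block_words_def)
    have "tword (v @ u) [] \<noteq> None"
      using u v by (auto simp: block_words_def descent_words_def shape_def tword_append)
    moreover have "dcomp (v @ u) = b # c # bs \<or> dcomp (v @ u) = (b + c) # bs"
      using dcomp_append[of v u c bs] l u assms by (auto simp: descent_words_def)
    ultimately show "v @ u \<in> descent_words (b # c # bs)" using n by (auto simp: descent_words_def)
  qed
  show "?R \<subseteq> ?L"
  proof
    fix x assume x: "x \<in> ?R"
    then have t: "tword x [] \<noteq> None" by (auto simp: descent_words_def)
    have "b \<le> length x \<and> sorted_wrt (>) (take b x) \<and> dcomp (drop b x) = c # bs"
      using x dcomp_split[of x b 0 "c # bs"] dcomp_split[of x b c bs] assms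
      by (auto simp: descent_words_def)
    then have "drop b x \<in> descent_words (c # bs)" "take b x \<in> block_words [b] (shape (drop b x))"
      using t tword_append[of "take b x" "drop b x" "[]"]
      by (auto simp: descent_words_def block_words_def shape_def split: bind_splits)
    then show "x \<in> ?L" by (intro image_eqI[of _ _ "(drop b x, take b x)"]) auto
  qed
qed

text \<open>With at most one part, ribbons are generators and descent words are block words. For
  more parts, \<open>ribbon_Cons2\<close> and \<open>descent_words_Cons2\<close> give the same
  recursion in terms of shorter compositions.\<close>

lemma ribbon_schur:
  "composition \<beta> \<Longrightarrow> ribbon \<beta> x = (\<Sum>w\<in>descent_words \<beta>. schur (shape w) x)"
proof (induction \<beta> arbitrary: x rule: measure_induct_rule[of length])
  case (less \<beta>)
  consider "\<beta> = []" | b where "\<beta> = [b]" | b c bs where "\<beta> = b # c # bs"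
    by (metis neq_Nil_conv)
  then show ?case
  proof cases
    case 1
    have "descent_words [] = block_words [] []" by (auto simp: descent_words_def block_words_def)
    moreover have "ribbon [] = hbasis []" by (auto simp: ribbon_def hbasis_def coarsens_Nil)
    ultimately show ?thesis using 1 hbasis_schur[of "[]"] by simp
  next
    case 2
    have "dcomp w = [b] \<longleftrightarrow> blocks [b] w" for w
      using dcomp_blocks[of w "[b]"] dcomp_sorted[of w] less.prems 2 by (cases "w = []") auto
    then have "descent_words [b] = block_words [b] []" by (auto simp: descent_words_def block_words_def)
    moreover have "ribbon [b] = hbasis [b]" by (auto simp: ribbon_def hbasis_def coarsens_single)
    ultimately show ?thesis using 2 hbasis_schur[of "[b]"] less.prems by simp
  next
    case 3
    then have pos: "0 < b" "0 < c" "composition bs" using less.prems by auto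
    let ?U = "descent_words (c # bs)"
    have ih: "ribbon (c # bs) = (\<lambda>x. \<Sum>w\<in>?U. schur (shape w) x)"
      "ribbon ((b + c) # bs) x = (\<Sum>w\<in>descent_words ((b + c) # bs). schur (shape w) x)"
      using less.IH[of "c # bs"] less.IH[of "(b + c) # bs"] pos 3 by auto
    have cu: "composition (shape u)" if "u \<in> ?U" for u
      using that descent_words_subset shape_comps by (fastforce simp: comps_def)
    have "nsym_mult (hbasis [b]) (ribbon (c # bs)) x =
      (\<Sum>u\<in>?U. \<Sum>v\<in>block_words [b] (shape u). schur (the (tword v (shape u))) x)"
      unfolding ih(1) nsym_mult_sum_right using cu pos by (intro sum.cong) (auto simp: hbasis_mult_schur)
    also have "\<dots> = (\<Sum>w\<in>descent_words (b # c # bs) \<union> descent_words ((b + c) # bs). schur (shape w) x)"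
      unfolding descent_words_Cons2[OF pos(1,2), symmetric]
      by (rule sum_words_append) (simp, simp add: descent_words_def)
    also have "\<dots> = (\<Sum>w\<in>descent_words (b # c # bs). schur (shape w) x) +
      (\<Sum>w\<in>descent_words ((b + c) # bs). schur (shape w) x)"
      using pos by (intro sum.union_disjoint finite_descent_words) (auto simp: descent_words_def)
    finally show ?thesis using ih(2) 3 ribbon_Cons2[OF pos(2), of b bs x] by simp
  qed
qed

text \<open>Existence is \<open>ribbon_schur\<close>; uniqueness on compositions is
  \<open>shape_sums_inj\<close> for descent words, and elsewhere the family is fixed to be
  zero.\<close>

lemma ncs_schur: "ncs = schur"
proof -
  have "ncs_family = schur"
    unfolding ncs_family_def sum_dcoef
  proof (rule the_equality)
    show "(\<forall>\<beta>. composition \<beta> \<longrightarrow> ribbon \<beta> = (\<lambda>\<gamma>. \<Sum>w\<in>descent_words \<beta>. schur (shape w) \<gamma>)) \<and>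
      (\<forall>\<alpha>. \<not> composition \<alpha> \<longrightarrow> schur \<alpha> = (\<lambda>_. 0))"
      using ribbon_schur schur_not_composition by blast
  next
    fix s :: "nat list \<Rightarrow> nsym"
    assume s: "(\<forall>\<beta>. composition \<beta> \<longrightarrow> ribbon \<beta> = (\<lambda>\<gamma>. \<Sum>w\<in>descent_words \<beta>. s (shape w) \<gamma>)) \<and>
      (\<forall>\<alpha>. \<not> composition \<alpha> \<longrightarrow> s \<alpha> = (\<lambda>_. 0))"
    have "s \<alpha> x = schur \<alpha> x" if "composition \<alpha>" for \<alpha> x
    proof (rule shape_sums_inj[where X = descent_words and f = "\<lambda>\<alpha>. s \<alpha> x" and g = "\<lambda>\<alpha>. schur \<alpha> x", OF _ _ that])
      fix \<gamma> assume "composition \<gamma>"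
      then show "(\<Sum>w\<in>descent_words \<gamma>. s (shape w) x) = (\<Sum>w\<in>descent_words \<gamma>. schur (shape w) x)"
        using s ribbon_schur[of \<gamma> x] by metis
    qed (use std_word_descent_words descent_words_subset in blast)
    then show "s = schur" using s schur_not_composition by (intro ext) metis
  qed
  then show ?thesis by (auto simp: ncs_def)
qed

section \<open>The Pieri rules\<close>

definition pieri_words :: "(nat list \<Rightarrow> bool) \<Rightarrow> nat \<Rightarrow> nat list \<Rightarrow> nat list set" where
  "pieri_words Q n \<alpha> = {is. length is = n \<and> Q is \<and> uword is \<alpha> \<noteq> None}"

lemma finite_pieri_words [simp]: "finite (pieri_words Q n \<alpha>)"
  by (rule finite_subset[OF _ finite_uword[of n \<alpha>]]) (auto simp: pieri_words_def)

text \<open>The identity is checked on each \<open>hbasis \<beta>\<close>. There the product is a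
  sum over block words acting on \<zeta>, that is, acting after \<open>is0\<close> on the empty
  composition; moving \<open>is0\<close> past such a word gives a block word followed by an index
  word with the pattern of \<open>is0\<close>.\<close>

lemma schur_mult_pieri:
  assumes Q: "\<And>is js. same_pattern (<) is js \<Longrightarrow> Q is \<longleftrightarrow> Q js"
    and base: "pieri_words Q n [] = {is0}" "uword is0 [] = Some \<zeta>"
    and "composition \<zeta>" "composition \<alpha>"
  shows "nsym_mult (schur \<alpha>) (schur \<zeta>) x = (\<Sum>is\<in>pieri_words Q n \<alpha>. schur (the (uword is \<alpha>)) x)"
proof (rule shape_sums_inj[where X = "\<lambda>\<gamma>. block_words \<gamma> []" and \<alpha> = \<alpha>])
  fix \<beta> assume b: "composition \<beta>"
  have "(\<Sum>w\<in>block_words \<beta> []. nsym_mult (schur (shape w)) (schur \<zeta>) x) =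
    nsym_mult (hbasis \<beta>) (schur \<zeta>) x"
    by (simp add: hbasis_schur[OF b] nsym_mult_sum_left)
  also have "\<dots> = (\<Sum>w\<in>block_words \<beta> \<zeta>. schur (the (tword w \<zeta>)) x)"
    using hbasis_mult_schur[OF b assms(4)] .
  also have "\<dots> = (\<Sum>(w, is)\<in>Sigma (block_words \<beta> []) (\<lambda>w. pieri_words Q n (shape w)).
      schur (the (uword is (shape w))) x)"
  \<comment> \<open>The way back needs only the column word of \<open>tgrid\<close>, since the index
    word that arrives at the empty composition is always \<open>is0\<close>.\<close>
  proof (rule sum.reindex_bij_witness[where i = "\<lambda>(w, is). fst (tgrid [] w is)" and j = "\<lambda>w. ugrid [] w is0"])
    fix v assume v: "v \<in> block_words \<beta> \<zeta>"
    then obtain \<delta> where d: "tword v \<zeta> = Some \<delta>" "blocks \<beta> v" by (auto simp: block_words_def)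
    obtain w "is" where g: "ugrid [] v is0 = (w, is)" by force
    from ugrid_forward[OF base(2) d(1) g] obtain \<mu> where
      m: "tword w [] = Some \<mu>" "uword is \<mu> = Some \<delta>" "tgrid [] w is = (v, is0)" by auto
    have p: "same_pattern (\<le>) w v" "same_pattern (<) is is0" using tgrid_forward[OF m] by auto
    show "(case ugrid [] v is0 of (w, is) \<Rightarrow> fst (tgrid [] w is)) = v" using g m by simp
    have "is0 \<in> pieri_words Q n []" using base by simp
    then have "length is = n" "Q is" using p Q same_pattern_length by (auto simp: pieri_words_def)
    then show "ugrid [] v is0 \<in> Sigma (block_words \<beta> []) (\<lambda>w. pieri_words Q n (shape w))"
      using g m p d same_pattern_blocks by (auto simp: block_words_def pieri_words_def shape_def)
    show "(case ugrid [] v is0 of (w, is) \<Rightarrow> schur (the (uword is (shape w))) x) = schur (the (tword v \<zeta>)) x"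
      using g m d by (simp add: shape_def)
  next
    fix a assume a: "a \<in> Sigma (block_words \<beta> []) (\<lambda>w. pieri_words Q n (shape w))"
    obtain w "is" where wi: "a = (w, is)" by force
    obtain \<mu> where m: "tword w [] = Some \<mu>" "blocks \<beta> w" using a wi by (auto simp: block_words_def)
    obtain \<delta> where d: "uword is \<mu> = Some \<delta>" "length is = n" "Q is"
      using a wi m by (auto simp: pieri_words_def shape_def)
    obtain v js where g: "tgrid [] w is = (v, js)" by force
    from tgrid_forward[OF m(1) d(1) g] obtain \<gamma> where
      c: "uword js [] = Some \<gamma>" "tword v \<gamma> = Some \<delta>" "ugrid [] v js = (w, is)"
        "same_pattern (\<le>) w v" "same_pattern (<) is js" by auto
    have "js \<in> pieri_words Q n []" using c d Q same_pattern_length by (auto simp: pieri_words_def)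
    \<comment> \<open>Here the uniqueness of the surviving index word enters; it also identifies the
      intermediate composition with \<zeta>.\<close>
    then have js: "js = is0" using base by simp
    then have "\<gamma> = \<zeta>" using c base by simp
    then show "(case a of (w, is) \<Rightarrow> fst (tgrid [] w is)) \<in> block_words \<beta> \<zeta>"
      using wi g c m same_pattern_blocks by (auto simp: block_words_def)
    show "ugrid [] (case a of (w, is) \<Rightarrow> fst (tgrid [] w is)) is0 = a" using wi g c js by simp
  qed
  also have "\<dots> = (\<Sum>w\<in>block_words \<beta> []. \<Sum>is\<in>pieri_words Q n (shape w). schur (the (uword is (shape w))) x)"
    by (simp add: sum.Sigma)
  finally show "(\<Sum>w\<in>block_words \<beta> []. nsym_mult (schur (shape w)) (schur \<zeta>) x) =
    (\<Sum>w\<in>block_words \<beta> []. \<Sum>is\<in>pieri_words Q n (shape w). schur (the (uword is (shape w))) x)" .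
qed (use assms std_word_block_words in auto)

lemma pieri_useq_sum:
  "(\<Sum>is\<in>{is. length is = n \<and> (\<forall>i\<in>set is. 0 < i) \<and> Q is \<and> useq is \<alpha> \<noteq> None}. f (the (useq is \<alpha>))) =
   (\<Sum>is\<in>pieri_words Q n \<alpha>. f (the (uword is \<alpha>)) :: rat)"
proof (rule sum.cong)
  show "{is. length is = n \<and> (\<forall>i\<in>set is. 0 < i) \<and> Q is \<and> useq is \<alpha> \<noteq> None} = pieri_words Q n \<alpha>"
    unfolding pieri_words_def using useq_uword uword_pos by (metis (no_types, lifting))
  show "f (the (useq is \<alpha>)) = f (the (uword is \<alpha>))" if "is \<in> pieri_words Q n \<alpha>" for "is"
  proof -
    have "uword is \<alpha> \<noteq> None" using that by (simp add: pieri_words_def)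
    then show ?thesis using useq_uword[OF uword_pos] by simp
  qed
qed

theorem theorem5p5:
  fixes \<alpha> :: "nat list" and n :: nat
  assumes "composition \<alpha>" and "0 < n"
  shows "nsym_mult (ncs \<alpha>) (ncs [n]) =
           (\<lambda>\<gamma>. \<Sum>is\<in>{is. length is = n \<and> (\<forall>i\<in>set is. 0 < i) \<and> sorted_wrt (<) is
                          \<and> useq is \<alpha> \<noteq> None}.
                 ncs (the (useq is \<alpha>)) \<gamma>) \<and>
         nsym_mult (ncs \<alpha>) (ncs (replicate n 1)) =
           (\<lambda>\<gamma>. \<Sum>is\<in>{is. length is = n \<and> (\<forall>i\<in>set is. 0 < i) \<and> sorted_wrt (\<ge>) is
                          \<and> useq is \<alpha> \<noteq> None}.
                 ncs (the (useq is \<alpha>)) \<gamma>)"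
proof
  have base: "pieri_words (sorted_wrt (<)) n [] = {[1..<Suc n]}"
    using uword_less_Nil(1)[OF assms(2)] by (simp add: pieri_words_def del: upt_Suc)
  have "composition [n]" using assms(2) by simp
  note pieri = schur_mult_pieri[OF same_pattern_less base uword_less_Nil(2)[OF assms(2)] this assms(1)]
  show "nsym_mult (ncs \<alpha>) (ncs [n]) =
           (\<lambda>\<gamma>. \<Sum>is\<in>{is. length is = n \<and> (\<forall>i\<in>set is. 0 < i) \<and> sorted_wrt (<) is
                          \<and> useq is \<alpha> \<noteq> None}.
                 ncs (the (useq is \<alpha>)) \<gamma>)"
    unfolding ncs_schur
    by (rule ext) (rule trans[OF pieri pieri_useq_sum[where f = "\<lambda>\<beta>. schur \<beta> x" for x, symmetric]])
next
  have base: "pieri_words (sorted_wrt (\<ge>)) n [] = {replicate n 1}"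
    using uword_ge_Nil by (simp add: pieri_words_def)
  have word: "uword (replicate n 1) [] = Some (replicate n 1)"
    by (simp add: uword_replicate[of n "[]", simplified])
  have "composition (replicate n 1)" by (simp add: composition_def)
  note pieri = schur_mult_pieri[OF same_pattern_ge base word this assms(1)]
  show "nsym_mult (ncs \<alpha>) (ncs (replicate n 1)) =
           (\<lambda>\<gamma>. \<Sum>is\<in>{is. length is = n \<and> (\<forall>i\<in>set is. 0 < i) \<and> sorted_wrt (\<ge>) is
                          \<and> useq is \<alpha> \<noteq> None}.
                 ncs (the (useq is \<alpha>)) \<gamma>)"
    unfolding ncs_schur
    by (rule ext) (rule trans[OF pieri pieri_useq_sum[where f = "\<lambda>\<beta>. schur \<beta> x" for x, symmetric]])
qed

end
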